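(* Consider the Gaussian non-random many-access channel in which, at blocklength $n$, there are $k_n$ users, all active with probability one, with noise variance $N_0/2$ per symbol, and let $\dot{C}$ be its capacity per unit-energy under the joint probability of error (symmetric codes). Then: 1) If $k_n = o(n/\log n)$, then any rate per unit-energy $\dot{R}$ satisfying $\dot{R} < \frac{\log e}{N_0}$ is achievable. Moreover, this rate can be achieved by an orthogonal-access scheme. 2) If $k_n = \omega(n/\log n)$, then $\dot{C}=0$. 3) If $k_n = \Theta(n/\log n)$, then $0 < \dot{C} < \frac{\log e}{N_0}$.
   Context: Logarithms $\log$ are to base 2. For nonnegative sequences: $a_n=O(b_n)$ means $\limsup a_n/b_n<\infty$; $a_n=o(b_n)$ means $\lim a_n/b_n=0$; $a_n=\Omega(b_n)$ means $\liminf a_n/b_n>0$; $a_n=\Theta(b_n)$ means both $O$ and $\Omega$; $a_n=\omega(b_n)$ means $\lim a_n/b_n=\infty$. Channel. At blocklength $n$ there are $k_n$ users (a positive integer depending on $n$). User $i$ has a message $W_i$; the messages are independent and uniform on $\{1,\ldots,M_n\}$. User $i$ sends a codeword $\mathbf{x}_i(W_i)\in\mathbb{R}^n$ and the receiver observes $\mathbf{Y}=\sum_{i=1}^{k_n}\mathbf{x}_i(W_i)+\mathbf{Z}$, where $\mathbf{Z}$ has $n$ i.i.d. $\mathcal{N}(0,N_0/2)$ components, independent of the messages; $N_0>0$ is fixed. Codes. A symmetric $(n,M_n,E_n,\epsilon)$ code consists of encoding functions $w\mapsto\mathbf{x}_i(w)$, $i=1,\ldots,k_n$ (one codebook per user),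 with $\sum_{j=1}^n x_{ij}(w)^2\le E_n$ for all $w$, and a decoding function mapping $\mathbf{Y}$ to $(\hat W_1,\ldots,\hat W_{k_n})$ whose joint probability of error satisfies $P_e^{(n)}=\Pr\{(\hat W_1,\ldots,\hat W_{k_n})\ne(W_1,\ldots,W_{k_n})\}\le\epsilon$. A rate per unit-energy $\dot R$ is $\epsilon$-achievable if for every $\delta>0$ there exists $n_0$ such that for every $n\ge n_0$ there is an $(n,M_n,E_n,\epsilon)$ code with $\frac{\log M_n}{E_n}>\dot R-\delta$. It is achievable if it is $\epsilon$-achievable for all $0<\epsilon<1$. The capacity per unit-energy $\dot C$ is the supremum of all achievable rates per unit-energy. An access scheme is orthogonal if, for any two distinct users $i$ and $j$, the inner product between $\mathbf{x}_i(w)$ and $\mathbf{x}_j(w')$ is zero for all $w,w'\in\{1,\ldots,M_n\}$. *)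

theory Defs
  imports "HOL-Probability.Probability" "HOL-Library.Landau_Symbols"
begin

text \<open>
  Users are indexed by \<open>{..<k}\<close>, channel uses by \<open>{..<n}\<close> and messages by \<open>{1..M}\<close>.
  A vector of \<open>\<real>\<^sup>n\<close> is a function on \<open>nat\<close> of which only the values on \<open>{..<n}\<close> matter
  (extensional on \<open>{..<n}\<close> where it is a point of a product space).
  A family of encoders \<open>x\<close> maps user \<open>i\<close>, message \<open>w\<close> and channel use \<open>j\<close> to the symbol
  \<open>x i w j\<close>; a decoder maps a received vector to the vector of all decoded messages.
\<close>

type_synonym encoders = "nat \<Rightarrow> nat \<Rightarrow> nat \<Rightarrow> real"
type_synonym decoder = "(nat \<Rightarrow> real) \<Rightarrow> nat \<Rightarrow> nat"

definition message_measure :: "nat \<Rightarrow> nat \<Rightarrow> (nat \<Rightarrow> nat) measure" where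
  "message_measure k M = (\<Pi>\<^sub>M i\<in>{..<k}. uniform_count_measure {1..M})"

text \<open>The second parameter of \<^const>\<open>normal_density\<close> is the standard deviation.\<close>

definition noise_measure :: "real \<Rightarrow> nat \<Rightarrow> (nat \<Rightarrow> real) measure" where
  "noise_measure N0 n =
     (\<Pi>\<^sub>M j\<in>{..<n}. density lborel (\<lambda>z. ennreal (normal_density 0 (sqrt (N0 / 2)) z)))"

definition channel_output ::
    "nat \<Rightarrow> nat \<Rightarrow> encoders \<Rightarrow> (nat \<Rightarrow> nat) \<Rightarrow> (nat \<Rightarrow> real) \<Rightarrow> nat \<Rightarrow> real" where
  "channel_output n k x w z = (\<lambda>j\<in>{..<n}. (\<Sum>i<k. x i (w i) j) + z j)"

definition joint_error_prob ::
    "real \<Rightarrow> nat \<Rightarrow> nat \<Rightarrow> nat \<Rightarrow> encoders \<Rightarrow> decoder \<Rightarrow> real" where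
  "joint_error_prob N0 n k M x g =
     measure (message_measure k M \<Otimes>\<^sub>M noise_measure N0 n)
       {(w, z) \<in> space (message_measure k M \<Otimes>\<^sub>M noise_measure N0 n).
          \<exists>i<k. g (channel_output n k x w z) i \<noteq> w i}"

definition symmetric_code ::
    "real \<Rightarrow> nat \<Rightarrow> nat \<Rightarrow> nat \<Rightarrow> real \<Rightarrow> real \<Rightarrow> encoders \<Rightarrow> decoder \<Rightarrow> bool" where
  "symmetric_code N0 k n M E \<epsilon> x g \<longleftrightarrow>
     M \<ge> 1 \<and>
     (\<forall>i<k. \<forall>w\<in>{1..M}. (\<Sum>j<n. (x i w j)\<^sup>2) \<le> E) \<and>
     g \<in> (\<Pi>\<^sub>M j\<in>{..<n}. borel) \<rightarrow>\<^sub>M (\<Pi>\<^sub>M i\<in>{..<k}. count_space {1..M}) \<and>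
     joint_error_prob N0 n k M x g \<le> \<epsilon>"

definition orthogonal_access :: "nat \<Rightarrow> nat \<Rightarrow> nat \<Rightarrow> encoders \<Rightarrow> bool" where
  "orthogonal_access k n M x \<longleftrightarrow>
     (\<forall>i<k. \<forall>j<k. i \<noteq> j \<longrightarrow>
        (\<forall>w\<in>{1..M}. \<forall>w'\<in>{1..M}. (\<Sum>l<n. x i w l * x j w' l) = 0))"

text \<open>
  The numbers \<open>M\<close> and \<open>E\<close> are chosen for each blocklength. \<open>E > 0\<close> makes the
  quotient meaningful; it excludes no code, since the energy bound may be increased.
\<close>

definition eps_achievable :: "real \<Rightarrow> (nat \<Rightarrow> nat) \<Rightarrow> real \<Rightarrow> real \<Rightarrow> bool" where
  "eps_achievable N0 k \<epsilon> R \<longleftrightarrow>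
     (\<forall>\<delta>>0. \<exists>n0. \<forall>n\<ge>n0. \<exists>M E x g.
        E > 0 \<and> symmetric_code N0 (k n) n M E \<epsilon> x g \<and> log 2 (real M) / E > R - \<delta>)"

definition achievable :: "real \<Rightarrow> (nat \<Rightarrow> nat) \<Rightarrow> real \<Rightarrow> bool" where
  "achievable N0 k R \<longleftrightarrow> (\<forall>\<epsilon>. 0 < \<epsilon> \<and> \<epsilon> < 1 \<longrightarrow> eps_achievable N0 k \<epsilon> R)"

definition orthogonal_eps_achievable :: "real \<Rightarrow> (nat \<Rightarrow> nat) \<Rightarrow> real \<Rightarrow> real \<Rightarrow> bool" where
  "orthogonal_eps_achievable N0 k \<epsilon> R \<longleftrightarrow>
     (\<forall>\<delta>>0. \<exists>n0. \<forall>n\<ge>n0. \<exists>M E x g.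
        E > 0 \<and> symmetric_code N0 (k n) n M E \<epsilon> x g \<and> orthogonal_access (k n) n M x \<and>
        log 2 (real M) / E > R - \<delta>)"

definition orthogonal_achievable :: "real \<Rightarrow> (nat \<Rightarrow> nat) \<Rightarrow> real \<Rightarrow> bool" where
  "orthogonal_achievable N0 k R \<longleftrightarrow>
     (\<forall>\<epsilon>. 0 < \<epsilon> \<and> \<epsilon> < 1 \<longrightarrow> orthogonal_eps_achievable N0 k \<epsilon> R)"

text \<open>
  The supremum is taken in \<^typ>\<open>ereal\<close>, so that it is meaningful without knowing that
  the set is bounded.
\<close>

definition capacity :: "real \<Rightarrow> (nat \<Rightarrow> nat) \<Rightarrow> ereal" where
  "capacity N0 k = (SUP R\<in>{R. achievable N0 k R}. ereal R)"

end

theory Submission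
  imports Defs "HOL-Real_Asymp.Real_Asymp"
begin

text \<open>
  Achievability: user \<open>i\<close> transmits only in its own block of \<open>N = n div k n\<close> channel uses, with
  antipodal codewords of amplitude \<open>\<surd>\<tau>\<close> and energy \<open>E = \<tau> N\<close>. A greedy choice gives
  \<open>exp (\<gamma> N)\<close> sign vectors, \<open>\<gamma> \<le> \<theta>\<^sup>2 / 2\<close>, whose pairwise correlations are at most \<open>\<theta> N\<close>.
  Decoding by a correlation threshold, the Gaussian tail bound and a union bound give a joint
  error of at most \<open>2 k exp (- \<beta> N)\<close> with \<open>\<beta> > 0\<close> provided that \<open>\<gamma> < (1 - \<eta> - \<theta>)\<^sup>2 \<tau> / N0\<close>.
  For \<open>k = o(n / log n)\<close> every \<open>\<beta> > 0\<close> suffices, and small \<open>\<theta>, \<eta>, \<tau>\<close> bring the rate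
  \<open>\<gamma> log e / \<tau>\<close> close to \<open>log e / N0\<close>. For \<open>k = O(n / log n)\<close> a large \<open>\<tau>\<close> makes \<open>\<beta>\<close> large enough.

  Converse: a data processing inequality for Gaussian vectors gives two bounds. If \<open>M \<ge> 2\<close>,
  distinguishing message vectors that differ in a single user forces \<open>E\<close> to be at least of order
  \<open>ln k\<close>. The sum rate obeys
  \<open>(1 - \<epsilon>) k ln M \<le> n / 2 ln (1 + 2 k E / (n N0)) + 1\<close>. If \<open>k \<ge> c n / log n\<close>, the first bound
  keeps \<open>2 k E / (n N0)\<close> above some \<open>u > 0\<close> proportional to \<open>c\<close>, and then the second one limits
  the rate per unit-energy to \<open>ln (1 + u) / u \<cdot> log e / N0\<close>, which is below \<open>log e / N0\<close> and tends
  to \<open>0\<close> as \<open>c\<close> grows.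
\<close>

section \<open>Gaussian product measures\<close>

text \<open>The preimage of a box under a coordinatewise map is again a box, so both measures give
  it the same product of masses. Needed to shift the noise vector by a signal.\<close>

lemma PiM_distr_componentwise:
  assumes "finite I" and M: "\<And>i. prob_space (M i)"
    and f [measurable]: "\<And>i. f i \<in> M i \<rightarrow>\<^sub>M N i"
  shows "distr (PiM I M) (PiM I N) (\<lambda>x. \<lambda>i\<in>I. f i (x i)) = PiM I (\<lambda>i. distr (M i) (N i) (f i))"
proof -
  interpret M: product_prob_space M by (intro product_prob_spaceI M)
  have D: "prob_space (distr (M i) (N i) (f i))" for i
    using M by (rule prob_space.prob_space_distr) simp
  interpret D: product_prob_space "\<lambda>i. distr (M i) (N i) (f i)" by (intro product_prob_spaceI D)
  show ?thesis
  proof (rule D.PiM_eqI[OF \<open>finite I\<close>])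
    show "sets (distr (PiM I M) (PiM I N) (\<lambda>x. \<lambda>i\<in>I. f i (x i))) = sets (PiM I (\<lambda>i. distr (M i) (N i) (f i)))"
      by (simp cong: sets_PiM_cong)
    fix A assume "\<And>i. i \<in> I \<Longrightarrow> A i \<in> sets (distr (M i) (N i) (f i))"
    then have A [measurable]: "\<And>i. i \<in> I \<Longrightarrow> A i \<in> sets (N i)" by simp
    have eq: "(\<lambda>x. \<lambda>i\<in>I. f i (x i)) -` Pi\<^sub>E I A \<inter> space (PiM I M) = Pi\<^sub>E I (\<lambda>i. f i -` A i \<inter> space (M i))"
      by (auto simp: space_PiM PiE_iff)
    have PA: "Pi\<^sub>E I A \<in> sets (PiM I N)" using A \<open>finite I\<close> by (intro sets_PiM_I_finite) auto
    have "emeasure (distr (PiM I M) (PiM I N) (\<lambda>x. \<lambda>i\<in>I. f i (x i))) (Pi\<^sub>E I A)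
        = emeasure (PiM I M) (Pi\<^sub>E I (\<lambda>i. f i -` A i \<inter> space (M i)))"
      using PA by (subst emeasure_distr) (auto simp: eq)
    also have "\<dots> = (\<Prod>i\<in>I. emeasure (M i) (f i -` A i \<inter> space (M i)))"
      using A \<open>finite I\<close> by (intro M.emeasure_PiM) auto
    also have "\<dots> = (\<Prod>i\<in>I. emeasure (distr (M i) (N i) (f i)) (A i))"
      using A by (intro prod.cong) (auto simp: emeasure_distr)
    finally show "emeasure (distr (PiM I M) (PiM I N) (\<lambda>x. \<lambda>i\<in>I. f i (x i))) (Pi\<^sub>E I A)
        = (\<Prod>i\<in>I. emeasure (distr (M i) (N i) (f i)) (A i))" .
  qed
qed

text \<open>The indicator of a box factorizes, so over a box the integral of the product density
  splits into one-dimensional integrals. Needed for the density ratio of two Gaussian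
  vectors.\<close>

lemma PiM_density:
  assumes "finite I" and M: "\<And>i. prob_space (M i)"
    and f [measurable]: "\<And>i. f i \<in> borel_measurable (M i)"
    and D: "\<And>i. prob_space (density (M i) (f i))"
  shows "PiM I (\<lambda>i. density (M i) (f i)) = density (PiM I M) (\<lambda>x. \<Prod>i\<in>I. f i (x i))"
proof -
  interpret M: product_prob_space M by (intro product_prob_spaceI M)
  interpret D: product_prob_space "\<lambda>i. density (M i) (f i)" by (intro product_prob_spaceI D)
  show ?thesis
  proof (rule D.PiM_eqI[OF \<open>finite I\<close>, symmetric])
    show "sets (density (PiM I M) (\<lambda>x. \<Prod>i\<in>I. f i (x i))) = sets (PiM I (\<lambda>i. density (M i) (f i)))"
      by (simp cong: sets_PiM_cong)
    fix A assume "\<And>i. i \<in> I \<Longrightarrow> A i \<in> sets (density (M i) (f i))"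
    then have A [measurable]: "\<And>i. i \<in> I \<Longrightarrow> A i \<in> sets (M i)" by simp
    have PA: "Pi\<^sub>E I A \<in> sets (PiM I M)" using A \<open>finite I\<close> by (intro sets_PiM_I_finite) auto
    have "emeasure (density (PiM I M) (\<lambda>x. \<Prod>i\<in>I. f i (x i))) (Pi\<^sub>E I A)
        = (\<integral>\<^sup>+x. (\<Prod>i\<in>I. f i (x i)) * indicator (Pi\<^sub>E I A) x \<partial>PiM I M)"
      by (intro emeasure_density PA) measurable
    also have "\<dots> = (\<integral>\<^sup>+x. (\<Prod>i\<in>I. f i (x i) * indicator (A i) (x i)) \<partial>PiM I M)"
    proof (rule nn_integral_cong)
      fix x assume "x \<in> space (PiM I M)"
      then have "(indicator (Pi\<^sub>E I A) x :: ennreal) = (\<Prod>i\<in>I. indicator (A i) (x i))"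
        using \<open>finite I\<close> by (auto simp: indicator_def space_PiM PiE_iff prod.neutral intro!: prod_zero[symmetric])
      then show "(\<Prod>i\<in>I. f i (x i)) * indicator (Pi\<^sub>E I A) x = (\<Prod>i\<in>I. f i (x i) * indicator (A i) (x i))"
        by (simp add: prod.distrib)
    qed
    also have "\<dots> = (\<Prod>i\<in>I. \<integral>\<^sup>+x. f i x * indicator (A i) x \<partial>M i)"
      using A \<open>finite I\<close> by (intro M.product_nn_integral_prod) auto
    also have "\<dots> = (\<Prod>i\<in>I. emeasure (density (M i) (f i)) (A i))"
      using A by (intro prod.cong) (auto simp: emeasure_density)
    finally show "emeasure (density (PiM I M) (\<lambda>x. \<Prod>i\<in>I. f i (x i))) (Pi\<^sub>E I A)
        = (\<Prod>i\<in>I. emeasure (density (M i) (f i)) (A i))" .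
  qed
qed

section \<open>Moments of one-dimensional Gaussian laws\<close>

definition gaussian :: "real \<Rightarrow> real \<Rightarrow> real measure" where
  "gaussian m s = density lborel (\<lambda>z. ennreal (normal_density m s z))"

lemma space_gaussian [simp]: "space (gaussian m s) = UNIV"
  by (simp add: gaussian_def)

lemma sets_gaussian [simp, measurable_cong]: "sets (gaussian m s) = sets borel"
  by (simp add: gaussian_def)

lemma prob_space_gaussian: "s > 0 \<Longrightarrow> prob_space (gaussian m s)"
  unfolding gaussian_def by (rule prob_space_normal_density)

lemma distr_gaussian_shift:
  assumes "s > 0"
  shows "distr (gaussian m s) borel (\<lambda>x. a + x) = gaussian (a + m) s"
proof -
  interpret prob_space "gaussian m s" using assms by (rule prob_space_gaussian)
  have "distributed (gaussian m s) lborel (\<lambda>x. x) (normal_density m s)"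
    by (auto simp: distributed_def gaussian_def distr_id2)
  from normal_density_affine[OF this assms, of 1 a]
  have "distr (gaussian m s) lborel (\<lambda>x. a + x) = gaussian (a + m) s"
    using assms by (simp add: distributed_def gaussian_def)
  moreover have "distr (gaussian m s) lborel (\<lambda>x. a + x) = distr (gaussian m s) borel (\<lambda>x. a + x)"
    by (intro distr_cong) auto
  ultimately show ?thesis by simp
qed

lemma gaussian_eq_density_gaussian:
  assumes "s > 0" "s' > 0"
  shows "gaussian m' s' = density (gaussian m s) (\<lambda>x. ennreal (normal_density m' s' x / normal_density m s x))"
proof -
  have "ennreal (normal_density m s x) * ennreal (normal_density m' s' x / normal_density m s x) = ennreal (normal_density m' s' x)" for x
    using normal_density_pos[OF assms(1), of m x] by (simp flip: ennreal_mult)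
  then show ?thesis by (simp add: gaussian_def density_density_eq)
qed

text \<open>Moment generating function: completing the square in the exponent turns the integrand
  into a multiple of the density with mean \<open>t * s\<^sup>2\<close>.\<close>

lemma nn_integral_gaussian_exp:
  assumes "s > 0"
  shows "(\<integral>\<^sup>+x. ennreal (exp (t * x)) \<partial>gaussian 0 s) = ennreal (exp (t\<^sup>2 * s\<^sup>2 / 2))"
proof -
  have "normal_density 0 s x * exp (t * x) = exp (t\<^sup>2 * s\<^sup>2 / 2) * normal_density (t * s\<^sup>2) s x" for x
  proof -
    have "- (x - 0)\<^sup>2 / (2 * s\<^sup>2) + t * x = t\<^sup>2 * s\<^sup>2 / 2 + - (x - t * s\<^sup>2)\<^sup>2 / (2 * s\<^sup>2)"
      using assms by (simp add: field_simps power2_eq_square)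
    then show ?thesis unfolding normal_density_def by (simp flip: exp_add)
  qed
  then have "(\<integral>\<^sup>+x. ennreal (exp (t * x)) \<partial>gaussian 0 s)
      = (\<integral>\<^sup>+x. ennreal (exp (t\<^sup>2 * s\<^sup>2 / 2)) * ennreal (normal_density (t * s\<^sup>2) s x) \<partial>lborel)"
    unfolding gaussian_def by (subst nn_integral_density) (auto simp flip: ennreal_mult)
  also have "\<dots> = ennreal (exp (t\<^sup>2 * s\<^sup>2 / 2))"
    using prob_space.emeasure_space_1[OF prob_space_gaussian[OF assms, of "t * s\<^sup>2"]]
    by (simp add: nn_integral_cmult gaussian_def emeasure_density)
  finally show ?thesis .
qed

lemma has_bochner_integral_gaussian_square:
  assumes "s > 0"
  shows "has_bochner_integral (gaussian m s) (\<lambda>x. (x - a)\<^sup>2) (s\<^sup>2 + (m - a)\<^sup>2)"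
proof -
  have 2: "has_bochner_integral lborel (\<lambda>x. normal_density m s x * (x - m)\<^sup>2) (s\<^sup>2)"
    using normal_moment_even[OF assms, of m 1] by simp
  have 1: "has_bochner_integral lborel (\<lambda>x. normal_density m s x * x) m"
    using assms by (rule normal_moment_nz_1)
  have 0: "has_bochner_integral lborel (\<lambda>x. normal_density m s x) 1"
    using assms by (simp add: has_bochner_integral_iff)
  \<comment> \<open>The three known moments combine through \<open>(x - a)\<^sup>2 = (x - m)\<^sup>2
    + 2 * (m - a) * x + (a\<^sup>2 - m\<^sup>2)\<close>.\<close>
  have "has_bochner_integral lborel (\<lambda>x. normal_density m s x * (x - m)\<^sup>2 + 2 * (m - a) * (normal_density m s x * x)
     + (a\<^sup>2 - m\<^sup>2) * normal_density m s x) (s\<^sup>2 + 2 * (m - a) * m + (a\<^sup>2 - m\<^sup>2) * 1)"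
    by (intro has_bochner_integral_add has_bochner_integral_mult_right 0 1 2)
  moreover have "(\<lambda>x. normal_density m s x * (x - m)\<^sup>2 + 2 * (m - a) * (normal_density m s x * x)
     + (a\<^sup>2 - m\<^sup>2) * normal_density m s x) = (\<lambda>x. normal_density m s x *\<^sub>R (x - a)\<^sup>2)"
    by (rule ext) (simp add: algebra_simps power2_eq_square)
  moreover have "s\<^sup>2 + 2 * (m - a) * m + (a\<^sup>2 - m\<^sup>2) * 1 = s\<^sup>2 + (m - a)\<^sup>2"
    by (simp add: algebra_simps power2_eq_square)
  ultimately have "has_bochner_integral lborel (\<lambda>x. normal_density m s x *\<^sub>R (x - a)\<^sup>2) (s\<^sup>2 + (m - a)\<^sup>2)"
    by (simp only:)
  then show ?thesis unfolding gaussian_def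
    by (intro has_bochner_integral_density) simp_all
qed

section \<open>Gaussian vectors: tail bound, shift and divergence\<close>

lemma prob_space_PiM_gaussian:
  "s > 0 \<Longrightarrow> prob_space (PiM I (\<lambda>j. gaussian (m j) s))"
  by (intro prob_space_PiM prob_space_gaussian)

lemma noise_measure_eq: "noise_measure N0 n = PiM {..<n} (\<lambda>_. gaussian 0 (sqrt (N0 / 2)))"
  by (simp add: noise_measure_def gaussian_def)

lemma sets_noise_measure [measurable_cong]: "sets (noise_measure N0 n) = sets (\<Pi>\<^sub>M j\<in>{..<n}. borel)"
  unfolding noise_measure_eq by (intro sets_PiM_cong) auto

lemma prob_space_noise_measure: "N0 > 0 \<Longrightarrow> prob_space (noise_measure N0 n)"
  unfolding noise_measure_eq by (intro prob_space_PiM prob_space_gaussian) simp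

text \<open>Chernoff bound: the correlation is a centred Gaussian of variance at most
  \<open>E * N0 / 2\<close>; independence factorizes its exponential moment and Markov's inequality
  bounds the tail.\<close>

lemma noise_inner_tail:
  assumes "N0 > 0" "(\<Sum>j<n. (a j)\<^sup>2) \<le> E" "t \<ge> 0"
  shows "measure (noise_measure N0 n) {z \<in> space (noise_measure N0 n). (\<Sum>j<n. a j * z j) \<ge> t * E}
    \<le> exp (- t\<^sup>2 * E / N0)"
proof -
  let ?N = "noise_measure N0 n"
  interpret prob_space ?N using assms(1) by (rule prob_space_noise_measure)
  \<comment> \<open>This \<open>u\<close> minimizes the Chernoff exponent
    \<open>- u * t * E + u\<^sup>2 * E * N0 / 4\<close>.\<close>
  define u where "u = 2 * t / N0"
  have u: "u \<ge> 0" using assms by (simp add: u_def)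
  interpret G: product_prob_space "\<lambda>_::nat. gaussian 0 (sqrt (N0 / 2))"
    using assms(1) by (intro product_prob_spaceI prob_space_gaussian) simp
  have mgf: "(\<integral>\<^sup>+z. ennreal (exp (u * (\<Sum>j<n. a j * z j))) \<partial>?N) \<le> ennreal (exp (t\<^sup>2 * E / N0))"
  proof -
    have "(\<integral>\<^sup>+z. ennreal (exp (u * (\<Sum>j<n. a j * z j))) \<partial>?N)
        = (\<integral>\<^sup>+z. (\<Prod>j<n. ennreal (exp ((u * a j) * z j))) \<partial>?N)"
      by (simp add: prod_ennreal sum_distrib_left mult.assoc flip: exp_sum)
    also have "\<dots> = (\<Prod>j<n. \<integral>\<^sup>+x. ennreal (exp ((u * a j) * x)) \<partial>gaussian 0 (sqrt (N0 / 2)))"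
      unfolding noise_measure_eq by (intro G.product_nn_integral_prod) auto
    also have "\<dots> = (\<Prod>j<n. ennreal (exp ((u * a j)\<^sup>2 * N0 / 4)))"
      using assms(1) by (simp add: nn_integral_gaussian_exp)
    also have "\<dots> = ennreal (exp (\<Sum>j<n. (u * a j)\<^sup>2 * N0 / 4))"
      by (simp add: prod_ennreal flip: exp_sum)
    also have "(\<Sum>j<n. (u * a j)\<^sup>2 * N0 / 4) = (t\<^sup>2 / N0) * (\<Sum>j<n. (a j)\<^sup>2)"
      using assms(1) by (simp add: sum_distrib_left u_def power2_eq_square field_simps)
    also have "\<dots> \<le> (t\<^sup>2 / N0) * E"
      using assms by (intro mult_left_mono) auto
    finally show ?thesis by simp
  qed
  \<comment> \<open>The tail event lies inside the event of Markov's inequality; writing it as an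
    intersection prepares the use of monotonicity.\<close>
  have "emeasure ?N {z \<in> space ?N. (\<Sum>j<n. a j * z j) \<ge> t * E}
      = emeasure ?N ({z \<in> space ?N. 1 \<le> ennreal (exp (- u * (t * E))) * ennreal (exp (u * (\<Sum>j<n. a j * z j)))} \<inter> {z \<in> space ?N. (\<Sum>j<n. a j * z j) \<ge> t * E})"
  proof (rule arg_cong[where f = "emeasure ?N"], safe)
    fix z assume "t * E \<le> (\<Sum>j<n. a j * z j)"
    then have "0 \<le> - u * (t * E) + u * (\<Sum>j<n. a j * z j)"
      using mult_left_mono[OF _ u] by fastforce
    then show "1 \<le> ennreal (exp (- u * (t * E))) * ennreal (exp (u * (\<Sum>j<n. a j * z j)))"
      by (simp flip: ennreal_mult exp_add)
  qed
  also have "\<dots> \<le> emeasure ?N ({z \<in> space ?N. 1 \<le> ennreal (exp (- u * (t * E))) * ennreal (exp (u * (\<Sum>j<n. a j * z j)))})"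
    by (intro emeasure_mono) (auto, measurable)
  also have "\<dots> \<le> ennreal (exp (- u * (t * E))) * (\<integral>\<^sup>+z. ennreal (exp (u * (\<Sum>j<n. a j * z j))) * indicator (space ?N) z \<partial>?N)"
    by (rule order_trans[OF _ nn_integral_Markov_inequality[where A = "space ?N"]]) (auto intro!: emeasure_mono, measurable)
  also have "(\<integral>\<^sup>+z. ennreal (exp (u * (\<Sum>j<n. a j * z j))) * indicator (space ?N) z \<partial>?N)
     = (\<integral>\<^sup>+z. ennreal (exp (u * (\<Sum>j<n. a j * z j))) \<partial>?N)"
    by (intro nn_integral_cong) (auto simp: indicator_def)
  also have "ennreal (exp (- u * (t * E))) * \<dots> \<le> ennreal (exp (- u * (t * E))) * ennreal (exp (t\<^sup>2 * E / N0))"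
    by (intro mult_left_mono mgf) auto
  also have "\<dots> = ennreal (exp (- t\<^sup>2 * E / N0))"
    by (simp add: u_def power2_eq_square flip: ennreal_mult exp_add)
  finally show ?thesis by (simp add: emeasure_eq_measure)
qed

lemma distr_noise_shift:
  assumes "N0 > 0"
  shows "distr (noise_measure N0 n) (\<Pi>\<^sub>M j\<in>{..<n}. borel) (\<lambda>z. \<lambda>j\<in>{..<n}. a j + z j)
    = PiM {..<n} (\<lambda>j. gaussian (a j) (sqrt (N0 / 2)))"
  using assms unfolding noise_measure_eq
  by (subst PiM_distr_componentwise) (auto simp: prob_space_gaussian distr_gaussian_shift)

lemma has_bochner_integral_PiM_gaussian_square:
  assumes "s > 0" "i \<in> I"
  shows "has_bochner_integral (PiM I (\<lambda>j. gaussian (m j) s)) (\<lambda>y. (y i - a)\<^sup>2) (s\<^sup>2 + (m i - a)\<^sup>2)"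
proof -
  have "distr (PiM I (\<lambda>j. gaussian (m j) s)) (gaussian (m i) s) (\<lambda>y. y i) = gaussian (m i) s"
    using assms by (intro distr_PiM_component prob_space_gaussian)
  moreover have "has_bochner_integral (gaussian (m i) s) (\<lambda>x. (x - a)\<^sup>2) (s\<^sup>2 + (m i - a)\<^sup>2)"
    using assms(1) by (rule has_bochner_integral_gaussian_square)
  ultimately have "has_bochner_integral (distr (PiM I (\<lambda>j. gaussian (m j) s)) (gaussian (m i) s) (\<lambda>y. y i))
      (\<lambda>x. (x - a)\<^sup>2) (s\<^sup>2 + (m i - a)\<^sup>2)"
    by simp
  moreover have [measurable]: "(\<lambda>y. y i) \<in> PiM I (\<lambda>j. gaussian (m j) s) \<rightarrow>\<^sub>M gaussian (m i) s"
    using assms(2) by (rule measurable_component_singleton)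
  ultimately show ?thesis
    by (simp add: has_bochner_integral_iff integrable_distr_eq integral_distr)
qed

lemma ln_normal_density_ratio:
  assumes "s > 0" "s' > 0"
  shows "ln (normal_density m' s' x / normal_density m s x)
    = - ln (s' / s) - (x - m')\<^sup>2 / (2 * s'\<^sup>2) + (x - m)\<^sup>2 / (2 * s\<^sup>2)"
proof -
  have "ln (normal_density \<mu> r x) = - ln (sqrt (2 * pi)) - ln r - (x - \<mu>)\<^sup>2 / (2 * r\<^sup>2)" if "r > 0" for \<mu> r :: real
    using that by (simp add: normal_density_def ln_mult ln_div real_sqrt_mult)
  then show ?thesis
    using assms normal_density_pos[OF assms(1), of m x] normal_density_pos[OF assms(2), of m' x]
    by (simp add: ln_div)
qed

text \<open>
  A data processing inequality for the divergence of two Gaussian vectors, obtained by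
  integrating \<open>1\<^sub>D ln L + ln r \<le> L\<^bsup>1\<^sub>D\<^esup> r - 1\<close>, where \<open>r\<close> is the density ratio.
\<close>

lemma gaussian_measure_le_divergence:
  fixes m m' :: "nat \<Rightarrow> real"
  assumes s: "s > 0" "s' > 0" and "L \<ge> 1"
    and D: "D \<in> sets (\<Pi>\<^sub>M j\<in>{..<n}. borel)"
  shows "measure (PiM {..<n} (\<lambda>j. gaussian (m j) s)) D * ln L
    \<le> real n * ln (s' / s) + (real n * s\<^sup>2 + (\<Sum>j<n. (m j - m' j)\<^sup>2)) / (2 * s'\<^sup>2) - real n / 2
      + L * measure (PiM {..<n} (\<lambda>j. gaussian (m' j) s')) D"
proof -
  let ?P = "PiM {..<n} (\<lambda>j. gaussian (m j) s)" and ?Q = "PiM {..<n} (\<lambda>j. gaussian (m' j) s')"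
  \<comment> \<open>Likelihood ratio of \<open>?Q\<close> with respect to \<open>?P\<close>.\<close>
  define r where "r y = (\<Prod>j<n. normal_density (m' j) s' (y j) / normal_density (m j) s (y j))" for y
  have pos: "0 < normal_density (m' j) s' x / normal_density (m j) s x" for j x
    using s by (simp add: normal_density_pos)
  have r_pos: "0 < r y" for y unfolding r_def by (intro prod_pos) (use pos in auto)
  interpret P: prob_space ?P using s by (intro prob_space_PiM_gaussian)
  interpret Q: prob_space ?Q using s by (intro prob_space_PiM_gaussian)
  have sets_P [simp]: "sets ?P = sets (\<Pi>\<^sub>M j\<in>{..<n}. borel)" and sets_Q [simp]: "sets ?Q = sets (\<Pi>\<^sub>M j\<in>{..<n}. borel)"
    by (intro sets_PiM_cong; simp)+
  have r_meas [measurable]: "r \<in> borel_measurable ?P" unfolding r_def by measurable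
  have Q_eq: "?Q = density ?P (\<lambda>y. ennreal (r y))"
  proof -
    have eq: "gaussian (m' j) s' = density (gaussian (m j) s) (\<lambda>x. ennreal (normal_density (m' j) s' x / normal_density (m j) s x))" for j
      using s by (rule gaussian_eq_density_gaussian)
    have "?Q = PiM {..<n} (\<lambda>j. density (gaussian (m j) s) (\<lambda>x. ennreal (normal_density (m' j) s' x / normal_density (m j) s x)))"
      by (simp only: eq[symmetric])
    also have "\<dots> = density ?P (\<lambda>y. \<Prod>j<n. ennreal (normal_density (m' j) s' (y j) / normal_density (m j) s (y j)))"
      by (intro PiM_density) (use s in \<open>simp_all add: prob_space_gaussian eq[symmetric]\<close>)
    also have "(\<lambda>y. \<Prod>j<n. ennreal (normal_density (m' j) s' (y j) / normal_density (m j) s (y j))) = (\<lambda>y. ennreal (r y))"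
      using pos by (simp add: r_def prod_ennreal less_imp_le)
    finally show ?thesis .
  qed
  have int_r: "has_bochner_integral ?P (\<lambda>y. r y * f y) (\<integral>y. f y \<partial>?Q)"
    if "integrable ?Q f" for f :: "_ \<Rightarrow> real"
  proof -
    have f [measurable]: "f \<in> borel_measurable ?P"
      using borel_measurable_integrable[OF that] by (simp cong: measurable_cong_sets)
    show ?thesis using that r_pos unfolding Q_eq
      by (simp add: has_bochner_integral_iff integrable_density integral_density less_imp_le)
  qed
  have iD: "has_bochner_integral ?P (\<lambda>y. r y * indicator D y) (measure ?Q D)"
    using int_r[of "indicator D"] D by (simp add: integrable_indicator_iff less_top[symmetric] Int_absorb2[OF sets.sets_into_space])
  have i1: "has_bochner_integral ?P r 1"
    using int_r[of "\<lambda>_. 1"] by (simp add: Q.prob_space)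
  have iP: "has_bochner_integral ?P (indicator D) (measure ?P D)"
    using D by (intro has_bochner_integral_real_indicator) (auto simp: less_top[symmetric])
  \<comment> \<open>\<open>K\<close> is the mean of \<open>ln r\<close> under \<open>?P\<close>,
    that is, minus the divergence. The zero terms \<open>m j - m j\<close> keep every summand in the
    form of the second moment formula.\<close>
  define K where "K = - real n * ln (s' / s) - (\<Sum>j<n. (s\<^sup>2 + (m j - m' j)\<^sup>2) / (2 * s'\<^sup>2)) + (\<Sum>j<n. (s\<^sup>2 + (m j - m j)\<^sup>2) / (2 * s\<^sup>2))"
  have ln_r: "ln (r y) = - real n * ln (s' / s) - (\<Sum>j<n. (y j - m' j)\<^sup>2 / (2 * s'\<^sup>2)) + (\<Sum>j<n. (y j - m j)\<^sup>2 / (2 * s\<^sup>2))" for y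
    unfolding r_def using pos s
    by (subst ln_prod) (simp_all add: less_imp_neq[OF normal_density_pos, symmetric] ln_normal_density_ratio sum.distrib sum_subtractf)
  have iln: "has_bochner_integral ?P (\<lambda>y. ln (r y)) K"
  proof -
    have "has_bochner_integral ?P (\<lambda>_. c) c" for c :: real
      by (simp add: has_bochner_integral_iff P.prob_space)
    then show ?thesis unfolding ln_r K_def using s
      by (intro has_bochner_integral_add has_bochner_integral_diff has_bochner_integral_sum
          has_bochner_integral_divide has_bochner_integral_PiM_gaussian_square) auto
  qed
  \<comment> \<open>Both cases are \<open>ln t \<le> t - 1\<close>, with \<open>t = L * r y\<close>
    on \<open>D\<close> and \<open>t = r y\<close> off it. After integration the mean of
    \<open>r\<close>, which is 1, cancels the constant.\<close>
  have pointwise: "indicator D y * ln L + ln (r y) \<le> L * (r y * indicator D y) + r y - 1" for y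
  proof (cases "y \<in> D")
    case True
    have "ln L + ln (r y) = ln (L * r y)" using r_pos[of y] \<open>L \<ge> 1\<close> by (simp add: ln_mult)
    also have "\<dots> \<le> L * r y - 1" using r_pos[of y] \<open>L \<ge> 1\<close> by (intro ln_le_minus_one) auto
    finally show ?thesis using True r_pos[of y] by simp
  next
    case False
    then show ?thesis using ln_le_minus_one[OF r_pos[of y]] by simp
  qed
  have 1: "has_bochner_integral ?P (\<lambda>y. indicator D y * ln L + ln (r y)) (measure ?P D * ln L + K)"
    by (intro has_bochner_integral_add iln has_bochner_integral_mult_left iP)
  have "has_bochner_integral ?P (\<lambda>_. 1) (1::real)"
    by (simp add: has_bochner_integral_iff P.prob_space)
  then have 2: "has_bochner_integral ?P (\<lambda>y. L * (r y * indicator D y) + r y - 1) (L * measure ?Q D + 1 - 1)"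
    by (intro has_bochner_integral_add has_bochner_integral_diff iD i1 has_bochner_integral_mult_right)
  have "measure ?P D * ln L + K \<le> L * measure ?Q D + 1 - 1"
    using integral_mono[OF integrable.intros[OF 1] integrable.intros[OF 2] pointwise]
    by (simp only: has_bochner_integral_integral_eq[OF 1] has_bochner_integral_integral_eq[OF 2])
  moreover have "K = - real n * ln (s' / s) - (real n * s\<^sup>2 + (\<Sum>j<n. (m j - m' j)\<^sup>2)) / (2 * s'\<^sup>2) + real n / 2"
    unfolding K_def using s by (simp add: sum.distrib flip: sum_divide_distrib)
  ultimately show ?thesis by simp
qed

section \<open>The joint error probability\<close>

text \<open>All points have the same mass \<open>1 / M ^ k\<close>, so averages over messages become
  finite sums.\<close>

lemma message_measure_eq:
  assumes "M \<ge> 1"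
  shows "message_measure k M = uniform_count_measure (PiE {..<k} (\<lambda>_. {1..M}))"
proof (rule measure_eqI_finite)
  have "sets (message_measure k M) = sets (PiM {..<k} (\<lambda>_. count_space {1..M}))"
    unfolding message_measure_def by (intro sets_PiM_cong) (auto simp: sets_uniform_count_measure)
  also have "\<dots> = Pow (PiE {..<k} (\<lambda>_. {1..M}))"
    by (subst count_space_PiM_finite) auto
  finally show "sets (message_measure k M) = Pow (PiE {..<k} (\<lambda>_. {1..M}))" .
  show "sets (uniform_count_measure (PiE {..<k} (\<lambda>_. {1..M}))) = Pow (PiE {..<k} (\<lambda>_. {1..M}))"
    by (simp add: sets_uniform_count_measure)
  show fin: "finite (PiE {..<k} (\<lambda>_. {1..M}))" by (intro finite_PiE) auto
  fix w assume w: "w \<in> PiE {..<k} (\<lambda>_. {1..M})"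
  have "prob_space (uniform_count_measure {1..M})"
    using assms by (intro prob_space_uniform_count_measure) auto
  then interpret U: product_prob_space "\<lambda>_::nat. uniform_count_measure {1..M}"
    by (rule product_prob_spaceI)
  have wM: "{w i} \<in> sets (uniform_count_measure {1..M})" if "i < k" for i
    using w that by (simp add: sets_uniform_count_measure PiE_iff)
  have "emeasure (message_measure k M) (PiE {..<k} (\<lambda>i. {w i})) = (\<Prod>i<k. emeasure (uniform_count_measure {1..M}) {w i})"
    unfolding message_measure_def by (intro U.emeasure_PiM wM) simp_all
  also have "\<dots> = (\<Prod>i<k. ennreal (1 / M))"
    using w by (intro prod.cong refl, subst emeasure_uniform_count_measure) (simp_all add: PiE_iff)
  also have "\<dots> = ennreal ((1 / M) ^ k)" by (simp add: ennreal_power)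
  also have "(1 / real M) ^ k = 1 / real (card (PiE {..<k} (\<lambda>_. {1..M})))"
    by (simp add: card_PiE power_one_over)
  also have "ennreal \<dots> = emeasure (uniform_count_measure (PiE {..<k} (\<lambda>_. {1..M}))) {w}"
    using w fin by (simp add: emeasure_uniform_count_measure)
  also have "PiE {..<k} (\<lambda>i. {w i}) = {w}" by (rule PiE_singleton) (use w in \<open>simp add: PiE_def\<close>)
  finally show "emeasure (message_measure k M) {w} = emeasure (uniform_count_measure (PiE {..<k} (\<lambda>_. {1..M}))) {w}" .
qed

lemma channel_output_measurable [measurable]:
  "channel_output n k x w \<in> noise_measure N0 n \<rightarrow>\<^sub>M (\<Pi>\<^sub>M j\<in>{..<n}. borel)"
  unfolding channel_output_def by measurable

lemma measurable_decoder_eq: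
  assumes "g \<in> (\<Pi>\<^sub>M j\<in>{..<n}. borel) \<rightarrow>\<^sub>M (\<Pi>\<^sub>M i\<in>{..<k}. count_space {1..M})" "i < k"
  shows "(\<lambda>y. g y i) \<in> (\<Pi>\<^sub>M j\<in>{..<n}. borel) \<rightarrow>\<^sub>M count_space {1..M}"
  using measurable_compose[OF assms(1) measurable_component_singleton] assms(2) by simp

text \<open>The error event splits into slices \<open>{w} \<times> Z w\<close> over the finitely
  many message vectors. Both the code construction and the converse start from this average.\<close>

lemma joint_error_prob_eq:
  assumes N0: "N0 > 0" and "M \<ge> 1"
    and g: "g \<in> (\<Pi>\<^sub>M j\<in>{..<n}. borel) \<rightarrow>\<^sub>M (\<Pi>\<^sub>M i\<in>{..<k}. count_space {1..M})"
  shows "joint_error_prob N0 n k M x g = (\<Sum>w\<in>PiE {..<k} (\<lambda>_. {1..M}).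
    measure (noise_measure N0 n) {z \<in> space (noise_measure N0 n). \<exists>i<k. g (channel_output n k x w z) i \<noteq> w i}) / real M ^ k"
proof -
  let ?W = "PiE {..<k} (\<lambda>_. {1..M})" and ?N = "noise_measure N0 n"
  define Z where "Z w = {z \<in> space ?N. \<exists>i<k. g (channel_output n k x w z) i \<noteq> w i}" for w
  interpret N: prob_space ?N using N0 by (rule prob_space_noise_measure)
  have fin: "finite ?W" by (intro finite_PiE) auto
  have ne: "?W \<noteq> {}" using \<open>M \<ge> 1\<close> by (simp add: PiE_eq_empty_iff)
  have card: "card ?W = M ^ k" by (simp add: card_PiE)
  have Zs: "Z w \<in> sets ?N" for w
  proof -
    have "(\<lambda>z. g (channel_output n k x w z) i) \<in> ?N \<rightarrow>\<^sub>M count_space {1..M}" if "i < k" for i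
      using measurable_compose[OF channel_output_measurable measurable_decoder_eq[OF g that]] .
    then have "{z \<in> space ?N. g (channel_output n k x w z) i \<noteq> w i} \<in> sets ?N" if "i < k" for i
      using that by measurable
    then have "(\<Union>i\<in>{..<k}. {z \<in> space ?N. g (channel_output n k x w z) i \<noteq> w i}) \<in> sets ?N"
      by (intro sets.finite_UN) auto
    also have "(\<Union>i\<in>{..<k}. {z \<in> space ?N. g (channel_output n k x w z) i \<noteq> w i}) = Z w"
      by (auto simp: Z_def)
    finally show ?thesis .
  qed
  have set_eq: "{(w, z) \<in> space (message_measure k M \<Otimes>\<^sub>M ?N). \<exists>i<k. g (channel_output n k x w z) i \<noteq> w i}
      = (\<Union>w\<in>?W. {w} \<times> Z w)"
    using \<open>M \<ge> 1\<close> by (auto simp: space_pair_measure message_measure_eq Z_def space_uniform_count_measure)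
  have meas: "{w} \<times> Z w \<in> sets (message_measure k M \<Otimes>\<^sub>M ?N)" if "w \<in> ?W" for w
    using that Zs \<open>M \<ge> 1\<close> by (intro pair_measureI) (auto simp: message_measure_eq sets_uniform_count_measure)
  have "prob_space (message_measure k M)"
    using \<open>M \<ge> 1\<close> fin ne by (simp add: message_measure_eq prob_space_uniform_count_measure)
  then interpret W: prob_space "message_measure k M" .
  interpret P: pair_prob_space "message_measure k M" ?N ..
  have "joint_error_prob N0 n k M x g = measure (message_measure k M \<Otimes>\<^sub>M ?N) (\<Union>w\<in>?W. {w} \<times> Z w)"
    unfolding joint_error_prob_def set_eq ..
  also have "\<dots> = (\<Sum>w\<in>?W. measure (message_measure k M \<Otimes>\<^sub>M ?N) ({w} \<times> Z w))"
    using fin meas by (intro P.finite_measure_finite_Union) (auto simp: disjoint_family_on_def)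
  also have "\<dots> = (\<Sum>w\<in>?W. measure ?N (Z w) / real M ^ k)"
  proof (rule sum.cong)
    fix w assume w: "w \<in> ?W"
    have "emeasure (message_measure k M \<Otimes>\<^sub>M ?N) ({w} \<times> Z w) = emeasure (message_measure k M) {w} * emeasure ?N (Z w)"
      using w Zs \<open>M \<ge> 1\<close> by (intro N.emeasure_pair_measure_Times) (auto simp: message_measure_eq sets_uniform_count_measure)
    also have "emeasure (message_measure k M) {w} = ennreal (1 / real M ^ k)"
      using w fin card \<open>M \<ge> 1\<close> by (simp add: message_measure_eq emeasure_uniform_count_measure)
    also have "\<dots> * emeasure ?N (Z w) = ennreal (measure ?N (Z w) / real M ^ k)"
      by (simp add: N.emeasure_eq_measure flip: ennreal_mult)
    finally show "measure (message_measure k M \<Otimes>\<^sub>M ?N) ({w} \<times> Z w) = measure ?N (Z w) / real M ^ k"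
      by (simp add: measure_def)
  qed simp
  finally show ?thesis unfolding Z_def by (simp add: sum_divide_distrib)
qed

section \<open>Orthogonal codes\<close>

text \<open>Each user is assigned the first message whose codeword correlates with the output to at
  least \<open>(1 - \<eta>) * E\<close>. Orthogonality removes the other users, so an error needs a
  noise correlation of at most \<open>- \<eta> * E\<close> with the sent codeword or at least
  \<open>(1 - \<eta> - \<theta>) * E\<close> with a wrong one. The tail bound and a union bound over
  users and messages finish.\<close>

lemma threshold_decoder_exists:
  fixes x :: encoders
  assumes N0: "N0 > 0" and "M \<ge> 1" and orth: "orthogonal_access k n M x"
    and energy: "\<And>i w. i < k \<Longrightarrow> w \<in> {1..M} \<Longrightarrow> (\<Sum>j<n. (x i w j)\<^sup>2) = E"
    and corr_le: "\<And>i v w. i < k \<Longrightarrow> v \<in> {1..M} \<Longrightarrow> w \<in> {1..M} \<Longrightarrow> v \<noteq> w \<Longrightarrow>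
      (\<Sum>j<n. x i v j * x i w j) \<le> \<theta> * E"
    and "\<eta> \<ge> 0" "\<eta> + \<theta> \<le> 1"
  shows "\<exists>g. symmetric_code N0 k n M E
    (real k * (exp (- \<eta>\<^sup>2 * E / N0) + real M * exp (- (1 - \<eta> - \<theta>)\<^sup>2 * E / N0))) x g"
proof -
  let ?Y = "\<Pi>\<^sub>M j\<in>{..<n}. (borel :: real measure)" and ?N = "noise_measure N0 n"
  let ?W = "PiE {..<k} (\<lambda>_. {1..M})"
  define corr where "corr i v y = (\<Sum>j<n. x i v j * y j)" for i v and y :: "nat \<Rightarrow> real"
  \<comment> \<open>Message \<open>M\<close> is the default when nothing passes the threshold, so
    \<open>LEAST\<close> always finds a value in \<open>{1..M}\<close>.\<close>
  define P where "P i y v \<longleftrightarrow> v \<in> {1..M} \<and> ((1 - \<eta>) * E \<le> corr i v y \<or> v = M)" for i y v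
  define g where "g y = (\<lambda>i\<in>{..<k}. LEAST v. P i y v)" for y
  define B where "B = exp (- \<eta>\<^sup>2 * E / N0) + real M * exp (- (1 - \<eta> - \<theta>)\<^sup>2 * E / N0)"
  interpret N: prob_space ?N using N0 by (rule prob_space_noise_measure)
  have corr_meas [measurable]: "corr i v \<in> borel_measurable ?Y" for i v
    unfolding corr_def by measurable
  have P_Least: "(LEAST v. P i y v) \<in> {1..M}" for i y
  proof -
    have "P i y M" using \<open>M \<ge> 1\<close> by (simp add: P_def)
    then have "P i y (LEAST v. P i y v)" by (rule LeastI)
    then show ?thesis by (simp add: P_def)
  qed
  have g_meas: "g \<in> ?Y \<rightarrow>\<^sub>M (\<Pi>\<^sub>M i\<in>{..<k}. count_space {1..M})"
    unfolding g_def
  proof (rule measurable_restrict)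
    fix i
    have [measurable]: "(\<lambda>y. LEAST v. P i y v) \<in> ?Y \<rightarrow>\<^sub>M count_space UNIV"
      unfolding P_def by measurable
    show "(\<lambda>y. LEAST v. P i y v) \<in> ?Y \<rightarrow>\<^sub>M count_space {1..M}"
      using P_Least measurable_sets[OF \<open>(\<lambda>y. LEAST v. P i y v) \<in> ?Y \<rightarrow>\<^sub>M count_space UNIV\<close>]
      by (subst measurable_count_space_eq2) auto
  qed
  have bound: "measure ?N {z \<in> space ?N. \<exists>i<k. g (channel_output n k x w z) i \<noteq> w i} \<le> real k * B"
    if w: "w \<in> ?W" for w
  proof -
    \<comment> \<open>\<open>A1\<close>: the noise drags the correct correlation down to the
      threshold (the codeword is negated because the tail bound concerns large values).
      \<open>A2\<close>: the noise can lift a wrong correlation up to it.\<close>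
    define A1 where "A1 i = {z \<in> space ?N. (\<Sum>j<n. (- x i (w i) j) * z j) \<ge> \<eta> * E}" for i
    define A2 where "A2 i v = {z \<in> space ?N. (\<Sum>j<n. x i v j * z j) \<ge> (1 - \<eta> - \<theta>) * E}" for i v
    have [measurable]: "A1 i \<in> sets ?N" "A2 i v \<in> sets ?N" for i v
      unfolding A1_def A2_def by measurable
    have wM: "w i \<in> {1..M}" if "i < k" for i using w that by (auto simp: PiE_iff)
    have corr_out: "corr i v (channel_output n k x w z) = (\<Sum>j<n. x i v j * x i (w i) j) + (\<Sum>j<n. x i v j * z j)"
      if i: "i < k" and v: "v \<in> {1..M}" for i v z
    proof -
      have "corr i v (channel_output n k x w z) = (\<Sum>j<n. (\<Sum>l<k. x i v j * x l (w l) j) + x i v j * z j)"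
        unfolding corr_def channel_output_def by (intro sum.cong) (auto simp: ring_distribs sum_distrib_left)
      also have "\<dots> = (\<Sum>l<k. \<Sum>j<n. x i v j * x l (w l) j) + (\<Sum>j<n. x i v j * z j)"
        by (subst sum.swap) (simp add: sum.distrib)
      \<comment> \<open>By orthogonality only user \<open>i\<close> contributes.\<close>
      also have "(\<Sum>l<k. \<Sum>j<n. x i v j * x l (w l) j) = (\<Sum>l<k. if l = i then \<Sum>j<n. x i v j * x i (w i) j else 0)"
        using orth i v wM unfolding orthogonal_access_def by (intro sum.cong) auto
      finally show ?thesis using i by simp
    qed
    have sub: "{z \<in> space ?N. \<exists>i<k. g (channel_output n k x w z) i \<noteq> w i}
      \<subseteq> (\<Union>i<k. A1 i \<union> (\<Union>v\<in>{1..M} - {w i}. A2 i v))"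
    proof (rule subsetI, rule ccontr)
      fix z assume z: "z \<in> {z \<in> space ?N. \<exists>i<k. g (channel_output n k x w z) i \<noteq> w i}"
        and nz: "z \<notin> (\<Union>i<k. A1 i \<union> (\<Union>v\<in>{1..M} - {w i}. A2 i v))"
      from z obtain i where i: "i < k" and ne: "g (channel_output n k x w z) i \<noteq> w i" by auto
      let ?y = "channel_output n k x w z"
      have "\<not> (\<Sum>j<n. (- x i (w i) j) * z j) \<ge> \<eta> * E"
        using nz i z unfolding A1_def by blast
      then have "(1 - \<eta>) * E \<le> corr i (w i) ?y"
        using corr_out[OF i wM[OF i], of z] energy[OF i wM[OF i]]
        by (simp add: sum_negf power2_eq_square algebra_simps)
      then have "P i ?y (w i)" using wM[OF i] by (simp add: P_def)
      moreover have "w i \<le> v" if Pv: "P i ?y v" for v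
      proof (rule ccontr)
        assume "\<not> w i \<le> v"
        \<comment> \<open>The default cannot pre-empt \<open>w i\<close>: a smaller \<open>v\<close>
          is below \<open>M\<close>, so it must have passed the threshold itself.\<close>
        then have v: "v \<noteq> w i" "v \<noteq> M" "v \<in> {1..M}" using Pv wM[OF i] by (auto simp: P_def)
        then have "(1 - \<eta>) * E \<le> corr i v ?y" using Pv by (simp add: P_def)
        then have "(1 - \<eta> - \<theta>) * E \<le> (\<Sum>j<n. x i v j * z j)"
          using corr_out[OF i v(3), of z] corr_le[OF i v(3) wM[OF i] v(1)] by (simp add: algebra_simps)
        then have "z \<in> A2 i v" using z by (simp add: A2_def)
        then show False using nz i v by blast
      qed
      ultimately have "(LEAST v. P i ?y v) = w i" by (rule Least_equality)
      then show False using ne i by (simp add: g_def)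
    qed
    have m1: "measure ?N (A1 i) \<le> exp (- \<eta>\<^sup>2 * E / N0)" if "i < k" for i
      unfolding A1_def using energy[OF that wM[OF that]] \<open>\<eta> \<ge> 0\<close> N0
      by (intro noise_inner_tail) (auto simp: power2_eq_square)
    have m2: "measure ?N (A2 i v) \<le> exp (- (1 - \<eta> - \<theta>)\<^sup>2 * E / N0)" if "i < k" "v \<in> {1..M}" for i v
      unfolding A2_def using energy[OF that] \<open>\<eta> + \<theta> \<le> 1\<close> N0
      by (intro noise_inner_tail) auto
    have m3: "measure ?N (A1 i \<union> (\<Union>v\<in>{1..M} - {w i}. A2 i v)) \<le> B" if i: "i < k" for i
    proof -
      have "measure ?N (A1 i \<union> (\<Union>v\<in>{1..M} - {w i}. A2 i v))
          \<le> measure ?N (A1 i) + measure ?N (\<Union>v\<in>{1..M} - {w i}. A2 i v)"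
        by (intro measure_Un_le) measurable
      also have "measure ?N (\<Union>v\<in>{1..M} - {w i}. A2 i v) \<le> (\<Sum>v\<in>{1..M} - {w i}. measure ?N (A2 i v))"
        by (intro N.finite_measure_subadditive_finite) auto
      also have "\<dots> \<le> real (card ({1..M} - {w i})) * exp (- (1 - \<eta> - \<theta>)\<^sup>2 * E / N0)"
        using m2[OF i] by (intro sum_bounded_above) auto
      also have "\<dots> \<le> real M * exp (- (1 - \<eta> - \<theta>)\<^sup>2 * E / N0)"
        using card_mono[of "{1..M}" "{1..M} - {w i}"] by (intro mult_right_mono) auto
      finally show ?thesis using m1[OF i] by (simp add: B_def)
    qed
    have "measure ?N {z \<in> space ?N. \<exists>i<k. g (channel_output n k x w z) i \<noteq> w i}
        \<le> measure ?N (\<Union>i<k. A1 i \<union> (\<Union>v\<in>{1..M} - {w i}. A2 i v))"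
      by (intro N.finite_measure_mono sub sets.finite_UN sets.Un) auto
    also have "\<dots> \<le> (\<Sum>i<k. measure ?N (A1 i \<union> (\<Union>v\<in>{1..M} - {w i}. A2 i v)))"
      by (intro N.finite_measure_subadditive_finite) auto
    also have "\<dots> \<le> real (card {..<k}) * B"
      using m3 by (intro sum_bounded_above) auto
    finally show ?thesis by simp
  qed
  have "joint_error_prob N0 n k M x g \<le> (\<Sum>w\<in>?W. real k * B) / real M ^ k"
    unfolding joint_error_prob_eq[OF N0 \<open>M \<ge> 1\<close> g_meas]
    by (intro divide_right_mono sum_mono bound) auto
  also have "\<dots> = real k * B" using \<open>M \<ge> 1\<close> by (simp add: card_PiE)
  finally show ?thesis
    unfolding symmetric_code_def using \<open>M \<ge> 1\<close> energy g_meas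
    by (intro exI[of _ g]) (auto simp: B_def)
qed

section \<open>Sign vectors with small pairwise correlations\<close>

lemma exp_add_exp_minus_le:
  fixes t :: real
  assumes "t \<ge> 0"
  shows "exp t + exp (- t) \<le> 2 * exp (t\<^sup>2 / 2)"
proof -
  \<comment> \<open>Auxiliary inequality of Hoeffding's lemma with probability 1/2 and range
    \<open>2 * t\<close>; multiplying by \<open>exp (- t)\<close> symmetrizes it into a bound on the
    hyperbolic cosine.\<close>
  have "- (2 * t) * (1 / 2) + ln (1 + 1 / 2 * (exp (2 * t) - 1)) \<le> (2 * t)\<^sup>2 / 8"
    using assms by (intro Hoeffdings_lemma_aux) auto
  then have "ln ((1 + exp (2 * t)) / 2) \<le> t + t\<^sup>2 / 2" by (simp add: field_simps power2_eq_square)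
  then have "exp (ln ((1 + exp (2 * t)) / 2)) \<le> exp (t + t\<^sup>2 / 2)" by simp
  then have "(1 + exp (2 * t)) / 2 \<le> exp (t + t\<^sup>2 / 2)" by (simp add: add_pos_pos)
  then have "exp (- t) * ((1 + exp (2 * t)) / 2) \<le> exp (- t) * exp (t + t\<^sup>2 / 2)"
    by (intro mult_left_mono) auto
  then show ?thesis by (simp add: ring_distribs flip: exp_add)
qed

text \<open>Chernoff bound by counting: weight each sign vector by the exponential of
  \<open>\<theta>\<close> times its inner product with \<open>a\<close>. Over all sign vectors the
  weights sum to \<open>(exp \<theta> + exp (- \<theta>)) ^ N\<close>, while each counted vector
  weighs at least \<open>exp (\<theta>\<^sup>2 * N)\<close>.\<close>

lemma sign_vectors_large_inner_card:
  fixes a :: "nat \<Rightarrow> real"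
  assumes "\<theta> \<ge> 0" and a: "\<And>j. j < N \<Longrightarrow> \<bar>a j\<bar> = 1"
  shows "real (card {b \<in> PiE {..<N} (\<lambda>_. {-1, 1}). (\<Sum>j<N. b j * a j) > \<theta> * N})
    \<le> 2 ^ N * exp (- \<theta>\<^sup>2 * N / 2)"
proof -
  let ?S = "PiE {..<N} (\<lambda>_. {-1, 1::real})"
  let ?B = "{b \<in> ?S. (\<Sum>j<N. b j * a j) > \<theta> * N}"
  have fin: "finite ?S" by (intro finite_PiE) auto
  have "real (card ?B) * exp (\<theta>\<^sup>2 * N) = (\<Sum>b\<in>?B. exp (\<theta>\<^sup>2 * N))" by simp
  also have "\<dots> \<le> (\<Sum>b\<in>?B. exp (\<theta> * (\<Sum>j<N. b j * a j)))"
  proof (rule sum_mono)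
    fix b assume "b \<in> ?B"
    then have "\<theta> * (\<theta> * N) \<le> \<theta> * (\<Sum>j<N. b j * a j)" using \<open>\<theta> \<ge> 0\<close> by (intro mult_left_mono) auto
    then show "exp (\<theta>\<^sup>2 * N) \<le> exp (\<theta> * (\<Sum>j<N. b j * a j))" by (simp add: power2_eq_square mult.assoc)
  qed
  also have "\<dots> \<le> (\<Sum>b\<in>?S. exp (\<theta> * (\<Sum>j<N. b j * a j)))"
    using fin by (intro sum_mono2) auto
  also have "\<dots> = (\<Sum>b\<in>?S. \<Prod>j<N. exp (\<theta> * (b j * a j)))"
    by (simp add: sum_distrib_left exp_sum)
  also have "\<dots> = (\<Prod>j<N. \<Sum>s\<in>{-1, 1}. exp (\<theta> * (s * a j)))"
    by (subst prod_sum_PiE) auto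
  also have "\<dots> = (\<Prod>j<N. exp \<theta> + exp (- \<theta>))"
  proof (rule prod.cong)
    fix j assume "j \<in> {..<N}"
    then have "a j = 1 \<or> a j = -1" using a[of j] by (auto simp: abs_if split: if_splits)
    then show "(\<Sum>s\<in>{-1, 1}. exp (\<theta> * (s * a j))) = exp \<theta> + exp (- \<theta>)" by auto
  qed simp
  also have "\<dots> = (exp \<theta> + exp (- \<theta>)) ^ N" by simp
  also have "\<dots> \<le> (2 * exp (\<theta>\<^sup>2 / 2)) ^ N"
    using exp_add_exp_minus_le[OF \<open>\<theta> \<ge> 0\<close>] by (intro power_mono) (auto intro: add_nonneg_nonneg)
  also have "\<dots> = 2 ^ N * exp (\<theta>\<^sup>2 / 2 * N)"
    by (simp add: power_mult_distrib mult.commute flip: exp_of_nat_mult)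
  finally have "real (card ?B) \<le> 2 ^ N * (exp (\<theta>\<^sup>2 / 2 * N) / exp (\<theta>\<^sup>2 * N))"
    by (simp add: pos_le_divide_eq)
  also have "exp (\<theta>\<^sup>2 / 2 * N) / exp (\<theta>\<^sup>2 * N) = exp (- \<theta>\<^sup>2 * N / 2)"
    by (subst exp_diff[symmetric]) simp
  finally show ?thesis .
qed

text \<open>
  Greedy choice: fewer than \<open>exp (\<theta>\<^sup>2 N / 2)\<close> codewords exclude less than all of
  the \<open>2\<^sup>N\<close> sign vectors.
\<close>

lemma sign_code_exists:
  assumes "\<theta> \<ge> 0" "real m \<le> exp (\<theta>\<^sup>2 * N / 2)"
  shows "\<exists>c :: nat \<Rightarrow> nat \<Rightarrow> real. (\<forall>v\<in>{1..m}. \<forall>j<N. \<bar>c v j\<bar> = 1) \<and>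
    (\<forall>v\<in>{1..m}. \<forall>w\<in>{1..m}. v \<noteq> w \<longrightarrow> (\<Sum>j<N. c v j * c w j) \<le> \<theta> * N)"
  using assms(2)
proof (induction m)
  case 0
  then show ?case by auto
next
  case (Suc m)
  then have "real m < exp (\<theta>\<^sup>2 * N / 2)" by simp
  from Suc.IH[OF less_imp_le[OF this]] obtain c :: "nat \<Rightarrow> nat \<Rightarrow> real" where c1: "\<And>v j. v \<in> {1..m} \<Longrightarrow> j < N \<Longrightarrow> \<bar>c v j\<bar> = 1"
    and c2: "\<And>v w. v \<in> {1..m} \<Longrightarrow> w \<in> {1..m} \<Longrightarrow> v \<noteq> w \<Longrightarrow> (\<Sum>j<N. c v j * c w j) \<le> \<theta> * N"
    by blast
  let ?S = "PiE {..<N} (\<lambda>_. {-1, 1::real})"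
  define B where "B v = {b \<in> ?S. (\<Sum>j<N. b j * c v j) > \<theta> * N}" for v
  have fin: "finite ?S" by (intro finite_PiE) auto
  have "real (card (\<Union>v\<in>{1..m}. B v)) \<le> (\<Sum>v\<in>{1..m}. real (card (B v)))"
    using card_UN_le[of "{1..m}" B] by (simp flip: of_nat_sum)
  also have "\<dots> \<le> real (card {1..m}) * (2 ^ N * exp (- \<theta>\<^sup>2 * N / 2))"
    unfolding B_def using c1 assms(1) by (intro sum_bounded_above sign_vectors_large_inner_card) auto
  \<comment> \<open>Strict, since \<open>m\<close> lies below the bound that \<open>Suc m\<close>
    still meets; hence some sign vector remains outside every \<open>B v\<close>.\<close>
  also have "\<dots> < exp (\<theta>\<^sup>2 * N / 2) * (2 ^ N * exp (- \<theta>\<^sup>2 * N / 2))"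
    using \<open>real m < exp (\<theta>\<^sup>2 * N / 2)\<close> by (intro mult_strict_right_mono) auto
  also have "\<dots> = real (card ?S)" by (simp add: card_PiE flip: exp_add)
  finally have "card (\<Union>v\<in>{1..m}. B v) < card ?S" by simp
  then have "\<not> ?S \<subseteq> (\<Union>v\<in>{1..m}. B v)"
    using card_mono[of "\<Union>v\<in>{1..m}. B v" ?S] fin by (auto simp: B_def)
  then obtain b where b: "b \<in> ?S" "\<And>v. v \<in> {1..m} \<Longrightarrow> b \<notin> B v" by blast
  have b1: "\<bar>b j\<bar> = 1" if "j < N" for j
    using PiE_mem[OF b(1), of j] that by auto
  have b2: "(\<Sum>j<N. b j * c v j) \<le> \<theta> * N" if "v \<in> {1..m}" for v
    using b(1) b(2)[OF that] by (simp add: B_def)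
  then have b3: "(\<Sum>j<N. c v j * b j) \<le> \<theta> * N" if "v \<in> {1..m}" for v
    using that by (simp add: mult.commute)
  show ?case
  proof (intro exI[of _ "c(Suc m := b)"] conjI ballI allI impI)
    fix v j assume "v \<in> {1..Suc m}" "j < N"
    then show "\<bar>(c(Suc m := b)) v j\<bar> = 1" using b1 c1 by auto
  next
    fix v w assume "v \<in> {1..Suc m}" "w \<in> {1..Suc m}" "v \<noteq> w"
    then show "(\<Sum>j<N. (c(Suc m := b)) v j * (c(Suc m := b)) w j) \<le> \<theta> * N"
      using b2 b3 c2 by (cases "v = Suc m"; cases "w = Suc m") auto
  qed
qed

lemma sum_block:
  fixes f :: "nat \<Rightarrow> real"
  assumes "i < k" "k * N \<le> n"
  shows "(\<Sum>j<n. if i * N \<le> j \<and> j < Suc i * N then f (j - i * N) else 0) = (\<Sum>l<N. f l)"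
proof -
  have "Suc i * N \<le> k * N" using assms(1) by (intro mult_right_mono) auto
  then have le: "Suc i * N \<le> n" using assms(2) by linarith
  have "(\<Sum>j<n. if i * N \<le> j \<and> j < Suc i * N then f (j - i * N) else 0) = (\<Sum>j\<in>{i * N..<Suc i * N}. f (j - i * N))"
    using le by (intro sum.mono_neutral_cong_right) auto
  also have "\<dots> = (\<Sum>l<N. f l)"
    by (rule sum.reindex_bij_witness[of _ "\<lambda>l. l + i * N" "\<lambda>j. j - i * N"]) auto
  finally show ?thesis .
qed

text \<open>Time division: all users share one sign code, scaled by \<open>sqrt \<tau>\<close> and
  sent in the user's own block of \<open>N\<close> channel uses. Energies are then exactly
  \<open>\<tau> * N\<close>, and inner products within a user scale by \<open>\<tau>\<close>, so the
  correlation ratio \<open>\<theta>\<close> is kept.\<close>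

lemma orthogonal_code_exists:
  assumes "N0 > 0" "\<tau> > 0" "\<theta> \<ge> 0" "\<eta> \<ge> 0" "\<eta> + \<theta> \<le> 1" "M \<ge> 1"
    and M: "real M \<le> exp (\<theta>\<^sup>2 * real N / 2)" and n: "k * N \<le> n"
  shows "\<exists>x g. orthogonal_access k n M x \<and> symmetric_code N0 k n M (\<tau> * real N)
    (real k * (exp (- \<eta>\<^sup>2 * (\<tau> * real N) / N0) + real M * exp (- (1 - \<eta> - \<theta>)\<^sup>2 * (\<tau> * real N) / N0))) x g"
proof -
  obtain c :: "nat \<Rightarrow> nat \<Rightarrow> real" where c1: "\<And>v j. v \<in> {1..M} \<Longrightarrow> j < N \<Longrightarrow> \<bar>c v j\<bar> = 1"
    and c2: "\<And>v w. v \<in> {1..M} \<Longrightarrow> w \<in> {1..M} \<Longrightarrow> v \<noteq> w \<Longrightarrow> (\<Sum>j<N. c v j * c w j) \<le> \<theta> * real N"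
    using sign_code_exists[OF \<open>\<theta> \<ge> 0\<close> M] by blast
  define x :: encoders where
    "x i w j = (if i * N \<le> j \<and> j < Suc i * N then sqrt \<tau> * c w (j - i * N) else 0)" for i w j
  have inner: "(\<Sum>j<n. x i v j * x i w j) = \<tau> * (\<Sum>l<N. c v l * c w l)" if "i < k" for i v w
  proof -
    have "(\<Sum>j<n. x i v j * x i w j)
        = (\<Sum>j<n. if i * N \<le> j \<and> j < Suc i * N then \<tau> * (c v (j - i * N) * c w (j - i * N)) else 0)"
      using \<open>\<tau> > 0\<close> by (intro sum.cong) (auto simp: x_def)
    also have "\<dots> = (\<Sum>l<N. \<tau> * (c v l * c w l))"
      using that n by (rule sum_block)
    finally show ?thesis by (simp add: sum_distrib_left)
  qed
  have orth: "orthogonal_access k n M x"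
    unfolding orthogonal_access_def
  proof (intro allI impI ballI sum.neutral)
    fix i i' w w' j :: nat assume "i \<noteq> i'"
    \<comment> \<open>Of two distinct blocks one ends before the other starts, so at each time at
      most one of the two users sends.\<close>
    then consider "Suc i * N \<le> i' * N" | "Suc i' * N \<le> i * N"
      by (metis Suc_leI linorder_neqE_nat mult_le_mono1)
    then show "x i w j * x i' w' j = 0"
      by cases (auto simp: x_def)
  qed
  moreover have "(\<Sum>j<n. (x i w j)\<^sup>2) = \<tau> * real N" if "i < k" "w \<in> {1..M}" for i w
  proof -
    have "(\<Sum>l<N. c w l * c w l) = (\<Sum>l<N. 1)"
      using c1[OF that(2)] by (intro sum.cong refl) (metis abs_mult_self_eq lessThan_iff mult_1)
    then show ?thesis using inner[OF that(1), of w w] by (simp add: power2_eq_square)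
  qed
  moreover have "(\<Sum>j<n. x i v j * x i w j) \<le> \<theta> * (\<tau> * real N)"
    if "i < k" "v \<in> {1..M}" "w \<in> {1..M}" "v \<noteq> w" for i v w
    using mult_left_mono[OF c2[OF that(2-4)], of \<tau>] \<open>\<tau> > 0\<close> by (simp add: inner[OF that(1)] mult_ac)
  ultimately show ?thesis
    using threshold_decoder_exists[OF \<open>N0 > 0\<close> \<open>M \<ge> 1\<close> orth, where E = "\<tau> * real N" and \<theta> = \<theta> and \<eta> = \<eta>] assms by blast
qed

section \<open>From block codes to achievable rates\<close>

lemma symmetric_code_mono:
  "symmetric_code N0 k n M E \<epsilon> x g \<Longrightarrow> \<epsilon> \<le> \<epsilon>' \<Longrightarrow> symmetric_code N0 k n M E \<epsilon>' x g"
  by (auto simp: symmetric_code_def)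

lemma orthogonal_achievable_imp_achievable:
  "orthogonal_achievable N0 k R \<Longrightarrow> achievable N0 k R"
  unfolding orthogonal_achievable_def achievable_def orthogonal_eps_achievable_def eps_achievable_def
  by meson

lemma orthogonal_achievable_mono:
  assumes "orthogonal_achievable N0 k R" "R' \<le> R"
  shows "orthogonal_achievable N0 k R'"
proof -
  have "R' - \<delta> < r" if "R - \<delta> < r" for \<delta> r :: real using that assms(2) by linarith
  then show ?thesis
    using assms(1) unfolding orthogonal_achievable_def orthogonal_eps_achievable_def by meson
qed

text \<open>\<open>\<gamma>\<close> is the message exponent per channel use of a block and
  \<open>\<beta>\<close> a common lower bound for the exponents of both error terms, so the joint
  error is at most \<open>2 * k n * exp (- \<beta> * N)\<close>. About \<open>\<gamma> * N\<close>
  nats are sent with energy \<open>\<tau> * N\<close>, whence the rate.\<close>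

lemma orthogonal_achievableI:
  assumes "N0 > 0" "\<tau> > 0" "\<theta> \<ge> 0" "\<eta> \<ge> 0" "\<eta> + \<theta> \<le> 1" and "\<gamma> > 0" "\<gamma> \<le> \<theta>\<^sup>2 / 2"
    and \<beta>: "\<beta> \<le> \<eta>\<^sup>2 * \<tau> / N0" "\<beta> \<le> (1 - \<eta> - \<theta>)\<^sup>2 * \<tau> / N0 - \<gamma>"
    and N: "filterlim (\<lambda>n. n div k n) at_top sequentially"
    and lim: "(\<lambda>n. real (k n) * exp (- \<beta> * real (n div k n))) \<longlonglongrightarrow> 0"
  shows "orthogonal_achievable N0 k (\<gamma> * log 2 (exp 1) / \<tau>)"
  unfolding orthogonal_achievable_def orthogonal_eps_achievable_def
proof (intro allI impI)
  fix \<epsilon> \<delta> :: real assume \<epsilon>: "0 < \<epsilon> \<and> \<epsilon> < 1" and \<delta>: "\<delta> > 0"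
  let ?L = "log 2 (exp 1)"
  have 1: "\<forall>\<^sub>F n in sequentially. real (k n) * exp (- \<beta> * real (n div k n)) < \<epsilon> / 2"
    using order_tendstoD(2)[OF lim, of "\<epsilon> / 2"] \<epsilon> by simp
  \<comment> \<open>Such a block length makes \<open>\<delta> * \<tau> * N\<close> exceed 1, which
    absorbs the bit lost by rounding \<open>M\<close>.\<close>
  have 2: "\<forall>\<^sub>F n in sequentially. n div k n > nat \<lceil>1 / (\<tau> * \<delta>)\<rceil>"
    using eventually_compose_filterlim[OF eventually_gt_at_top N] .
  have "\<forall>\<^sub>F n in sequentially. \<exists>M E x g. E > 0 \<and> symmetric_code N0 (k n) n M E \<epsilon> x g \<and>
      orthogonal_access (k n) n M x \<and> log 2 (real M) / E > \<gamma> * ?L / \<tau> - \<delta>"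
    using 1 2
  proof eventually_elim
    case (elim n)
    define N where "N = n div k n"
    have N_gt: "real N > 1 / (\<tau> * \<delta>)" using elim(2) unfolding N_def by linarith
    moreover have "1 / (\<tau> * \<delta>) > 0" using \<open>\<tau> > 0\<close> \<delta> by simp
    ultimately have N_pos: "real N > 0" by linarith
    define M where "M = nat \<lfloor>exp (\<gamma> * N)\<rfloor>"
    have e1: "exp (\<gamma> * N) \<ge> 1" using \<open>\<gamma> > 0\<close> by simp
    then have M1: "M \<ge> 1" unfolding M_def by linarith
    have M_le: "real M \<le> exp (\<gamma> * N)" unfolding M_def using e1 by linarith
    have "real M > exp (\<gamma> * N) - 1" unfolding M_def using e1 by linarith
    \<comment> \<open>Rounding down costs at most a factor 2, that is, one bit.\<close>
    then have M_ge: "2 * real M \<ge> exp (\<gamma> * N)" using M1 by linarith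
    have "\<gamma> * N \<le> \<theta>\<^sup>2 * N / 2" using mult_right_mono[OF \<open>\<gamma> \<le> \<theta>\<^sup>2 / 2\<close>, of "real N"] by simp
    then have "real M \<le> exp (\<theta>\<^sup>2 * N / 2)" using M_le by (meson exp_le_cancel_iff order_trans)
    moreover have "k n * N \<le> n" unfolding N_def by simp
    ultimately obtain x g where orth: "orthogonal_access (k n) n M x"
      and code: "symmetric_code N0 (k n) n M (\<tau> * N) (real (k n) * (exp (- \<eta>\<^sup>2 * (\<tau> * real N) / N0)
          + real M * exp (- (1 - \<eta> - \<theta>)\<^sup>2 * (\<tau> * real N) / N0))) x g"
      using orthogonal_code_exists[OF assms(1-5) M1] by blast
    have "real M * exp (- (1 - \<eta> - \<theta>)\<^sup>2 * (\<tau> * real N) / N0)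
        \<le> exp (\<gamma> * N) * exp (- (1 - \<eta> - \<theta>)\<^sup>2 * (\<tau> * real N) / N0)"
      using M_le by (intro mult_right_mono) auto
    also have "\<dots> = exp (- ((1 - \<eta> - \<theta>)\<^sup>2 * \<tau> / N0 - \<gamma>) * N)"
      by (simp add: algebra_simps flip: exp_add)
    also have "\<dots> \<le> exp (- \<beta> * N)" using mult_right_mono[OF \<beta>(2), of "real N"] by (simp add: algebra_simps)
    finally have b2: "real M * exp (- (1 - \<eta> - \<theta>)\<^sup>2 * (\<tau> * real N) / N0) \<le> exp (- \<beta> * N)" .
    have b1: "exp (- \<eta>\<^sup>2 * (\<tau> * real N) / N0) \<le> exp (- \<beta> * N)"
      using mult_right_mono[OF \<beta>(1), of "real N"] by simp
    have "real (k n) * (exp (- \<eta>\<^sup>2 * (\<tau> * real N) / N0) + real M * exp (- (1 - \<eta> - \<theta>)\<^sup>2 * (\<tau> * real N) / N0))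
        \<le> real (k n) * (exp (- \<beta> * N) + exp (- \<beta> * N))"
      by (intro mult_left_mono add_mono b1 b2) auto
    also have "\<dots> \<le> \<epsilon>" using elim(1) by (simp add: N_def)
    finally have "symmetric_code N0 (k n) n M (\<tau> * N) \<epsilon> x g"
      by (rule symmetric_code_mono[OF code])
    moreover have "\<tau> * N > 0" using N_pos \<open>\<tau> > 0\<close> by simp
    moreover have "log 2 (real M) / (\<tau> * N) > \<gamma> * ?L / \<tau> - \<delta>"
    proof -
      have "\<gamma> * N * ?L = log 2 (exp (\<gamma> * N))" by (simp add: log_def)
      also have "\<dots> \<le> log 2 (2 * real M)" using M_ge M1 by (intro log_mono) auto
      also have "\<dots> = 1 + log 2 (real M)" using M1 by (simp add: log_mult)
      finally have "\<gamma> * N * ?L - 1 \<le> log 2 (real M)" by simp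
      moreover have "1 < \<delta> * (\<tau> * N)" using N_gt \<open>\<tau> > 0\<close> \<delta> by (simp add: field_simps)
      moreover have "(\<gamma> * ?L / \<tau> - \<delta>) * (\<tau> * N) = \<gamma> * N * ?L - \<delta> * (\<tau> * N)"
        using \<open>\<tau> > 0\<close> by (simp add: left_diff_distrib)
      ultimately have "(\<gamma> * ?L / \<tau> - \<delta>) * (\<tau> * N) < log 2 (real M)"
        by linarith
      then show ?thesis using \<open>\<tau> * N > 0\<close> by (simp add: pos_less_divide_eq)
    qed
    ultimately show ?case using orth by blast
  qed
  then show "\<exists>n0. \<forall>n\<ge>n0. \<exists>M E x g. E > 0 \<and> symmetric_code N0 (k n) n M E \<epsilon> x g \<and>
      orthogonal_access (k n) n M x \<and> log 2 (real M) / E > \<gamma> * ?L / \<tau> - \<delta>"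
    by (simp add: eventually_sequentially)
qed

text \<open>The load bound makes blocks at least \<open>log 2 n / c - 1\<close> long. Then
  \<open>exp (- \<beta> * N)\<close> is at most a constant times
  \<open>n powr (- \<beta> / (c * ln 2))\<close>, and \<open>\<beta> > c * ln 2\<close> lets this
  power beat the number of users.\<close>

lemma blocks_grow:
  fixes k :: "nat \<Rightarrow> nat"
  assumes "c > 0" and k_pos: "\<And>n. k n > 0"
    and k_le: "\<forall>\<^sub>F n in sequentially. real (k n) \<le> c * (real n / log 2 (real n))"
  shows "filterlim (\<lambda>n. n div k n) at_top sequentially"
    and "\<beta> > c * ln 2 \<Longrightarrow> (\<lambda>n. real (k n) * exp (- \<beta> * real (n div k n))) \<longlonglongrightarrow> 0"
proof -
  have log_pos: "\<forall>\<^sub>F n in sequentially. log 2 (real n) > 0"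
    by real_asymp
  have lower: "\<forall>\<^sub>F n in sequentially. log 2 (real n) / c - 1 \<le> real (n div k n)"
    using k_le log_pos
  proof eventually_elim
    case (elim n)
    have "log 2 (real n) / c \<le> real n / real (k n)"
      using elim k_pos[of n] \<open>c > 0\<close> by (simp add: field_simps)
    \<comment> \<open>The added 1 pays for the rounding in \<open>n div k n\<close>.\<close>
    also have "\<dots> \<le> real (n div k n) + 1"
    proof -
      have "n < (n div k n + 1) * k n"
        using div_mult_mod_eq[of n "k n"] mod_less_divisor[OF k_pos[of n], of n]
        unfolding add_mult_distrib mult_1 by linarith
      then have "real n < (real (n div k n) + 1) * real (k n)"
        by (metis of_nat_1 of_nat_add of_nat_less_iff of_nat_mult)
      then show ?thesis using k_pos[of n] by (simp add: pos_divide_le_eq)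
    qed
    finally show ?case by simp
  qed
  have "filterlim (\<lambda>n. log 2 (real n) / c - 1) at_top sequentially"
    using \<open>c > 0\<close> by real_asymp
  then have "filterlim (\<lambda>n. real (n div k n)) at_top sequentially"
    using lower by (rule filterlim_at_top_mono)
  then show "filterlim (\<lambda>n. n div k n) at_top sequentially"
    by (simp only: filterlim_sequentially_iff_filterlim_real)
  assume \<beta>: "\<beta> > c * ln 2"
  moreover have "c * ln 2 > 0" using \<open>c > 0\<close> by simp
  ultimately have "\<beta> > 0" by linarith
  have upper: "\<forall>\<^sub>F n in sequentially. real (k n) * exp (- \<beta> * real (n div k n))
      \<le> c * (real n / log 2 (real n)) * exp (- \<beta> * (log 2 (real n) / c - 1))"
    using k_le lower
  proof eventually_elim
    case (elim n)
    have "exp (- \<beta> * real (n div k n)) \<le> exp (- \<beta> * (log 2 (real n) / c - 1))"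
      using elim(2) \<open>\<beta> > 0\<close> by simp
    then show ?case using elim(1) by (intro mult_mono) auto
  qed
  have lim: "(\<lambda>n. c * (real n / log 2 (real n)) * exp (- \<beta> * (log 2 (real n) / c - 1))) \<longlonglongrightarrow> 0"
  proof -
    define b where "b = \<beta> / (c * ln 2)"
    have b: "b > 1" using \<beta> \<open>c > 0\<close> by (simp add: b_def)
    have "(\<lambda>n. c * (real n / log 2 (real n)) * (exp \<beta> * real n powr (- b))) \<longlonglongrightarrow> 0"
      using b \<open>c > 0\<close> by real_asymp
    moreover have "\<forall>\<^sub>F n in sequentially. c * (real n / log 2 (real n)) * (exp \<beta> * real n powr (- b))
        = c * (real n / log 2 (real n)) * exp (- \<beta> * (log 2 (real n) / c - 1))"
      using eventually_gt_at_top[of 0]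
    proof eventually_elim
      case (elim n)
      have "exp \<beta> * real n powr (- b) = exp (- \<beta> * (log 2 (real n) / c - 1))"
        using elim \<open>c > 0\<close> by (simp add: powr_def b_def log_def field_simps flip: exp_add)
      then show ?case by simp
    qed
    ultimately show ?thesis by (rule Lim_transform_eventually)
  qed
  show "(\<lambda>n. real (k n) * exp (- \<beta> * real (n div k n))) \<longlonglongrightarrow> 0"
    by (rule tendsto_sandwich[OF _ upper tendsto_const lim]) auto
qed

lemma orthogonal_achievable_small_load:
  fixes k :: "nat \<Rightarrow> nat"
  assumes N0: "N0 > 0" and k_pos: "\<And>n. k n > 0"
    and k: "(\<lambda>n. real (k n)) \<in> o(\<lambda>n. real n / log 2 (real n))"
    and R: "R < log 2 (exp 1) / N0"
  shows "orthogonal_achievable N0 k R"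
proof -
  define L where "L = log 2 (exp (1::real))"
  have L: "L > 0" by (simp add: L_def)
  \<comment> \<open>\<open>h\<close> serves as both \<open>\<theta>\<close> and
    \<open>\<eta>\<close>. At most the fraction \<open>5 * h\<close> of the limiting rate is given
    up below; the cap \<open>1/10\<close> keeps \<open>1 - h - h\<close> positive.\<close>
  define h where "h = min (1/10) ((1 - R * N0 / L) / 5)"
  have "R * N0 / L < 1" using R N0 L unfolding L_def[symmetric] by (simp add: field_simps)
  then have h: "h > 0" "h \<le> 1/10" "5 * h \<le> 1 - R * N0 / L"
    using min.cobounded1[of "1/10" "(1 - R * N0 / L) / 5"] min.cobounded2[of "1/10" "(1 - R * N0 / L) / 5"]
    unfolding h_def by (simp_all del: min.cobounded1 min.cobounded2)
  \<comment> \<open>This power makes \<open>\<gamma> \<le> h\<^sup>2 / 2\<close>, the size limit of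
    the sign code.\<close>
  define \<tau> where "\<tau> = N0 * h\<^sup>2 / 2"
  \<comment> \<open>The fraction \<open>1 - h\<close> of the exponent for wrong codewords is spent
    on messages; the remaining fraction \<open>h\<close> is left for \<open>\<beta>\<close>.\<close>
  define \<gamma> where "\<gamma> = (1 - h - h)\<^sup>2 * (1 - h) * \<tau> / N0"
  define \<beta> where "\<beta> = min (h\<^sup>2 * \<tau> / N0) ((1 - h - h)\<^sup>2 * h * \<tau> / N0)"
  have \<tau>: "\<tau> > 0" using N0 h by (simp add: \<tau>_def)
  have \<beta>: "\<beta> > 0" using h N0 \<tau> by (simp add: \<beta>_def)
  have \<gamma>: "\<gamma> > 0" using h N0 \<tau> by (simp add: \<gamma>_def)
  have "(1 - h - h)\<^sup>2 * (1 - h) \<le> 1"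
    using h by (intro mult_le_one power_le_one) auto
  then have \<gamma>_le: "\<gamma> \<le> h\<^sup>2 / 2"
    using mult_right_mono[of "(1 - h - h)\<^sup>2 * (1 - h)" 1 "h\<^sup>2 / 2"] N0 by (simp add: \<gamma>_def \<tau>_def)
  \<comment> \<open>Half of the largest load constant that \<open>\<beta>\<close> tolerates; a load
    of smaller order eventually falls below every such multiple.\<close>
  define c where "c = \<beta> / (2 * ln 2)"
  have c: "c > 0" "\<beta> > c * ln 2" using \<beta> by (simp_all add: c_def)
  have "\<forall>\<^sub>F n in sequentially. norm (real (k n)) \<le> c * norm (real n / log 2 (real n))"
    using landau_o.smallD[OF k c(1)] .
  moreover have "\<forall>\<^sub>F n in sequentially. real n / log 2 (real n) \<ge> 0" by real_asymp
  ultimately have k_le: "\<forall>\<^sub>F n in sequentially. real (k n) \<le> c * (real n / log 2 (real n))"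
    by eventually_elim (simp only: real_norm_def abs_of_nonneg of_nat_0_le_iff)
  have "orthogonal_achievable N0 k (\<gamma> * log 2 (exp 1) / \<tau>)"
  proof (rule orthogonal_achievableI[OF N0 \<tau> _ _ _ \<gamma> \<gamma>_le])
    show "\<beta> \<le> (1 - h - h)\<^sup>2 * \<tau> / N0 - \<gamma>"
      by (simp add: \<beta>_def \<gamma>_def min_le_iff_disj algebra_simps flip: diff_divide_distrib)
  qed (use h blocks_grow[OF c(1) k_pos k_le] c(2) in \<open>auto simp: \<beta>_def\<close>)
  moreover have "R \<le> \<gamma> * log 2 (exp 1) / \<tau>"
  proof -
    have "R * N0 / L \<le> 1 - 5 * h" using h(3) by simp
    also have "\<dots> \<le> (1 - h - h)\<^sup>2 * (1 - h)"
    proof -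
      have "(1 - h - h)\<^sup>2 * (1 - h) - (1 - 5 * h) = 4 * h\<^sup>2 * (2 - h)"
        by (simp add: algebra_simps power2_eq_square)
      moreover have "4 * h\<^sup>2 * (2 - h) \<ge> 0" using h by simp
      ultimately show ?thesis by linarith
    qed
    finally have "R * N0 / L * (L / N0) \<le> (1 - h - h)\<^sup>2 * (1 - h) * (L / N0)"
      using L N0 by (intro mult_right_mono) auto
    then show ?thesis using L N0 \<tau> by (simp add: \<gamma>_def L_def mult.commute)
  qed
  ultimately show ?thesis by (rule orthogonal_achievable_mono)
qed

text \<open>Now \<open>\<beta>\<close> must exceed \<open>c * ln 2\<close> for a load constant
  \<open>c\<close> that is given, so the power \<open>\<tau>\<close> is raised until both error
  exponents allow it. As \<open>\<tau>\<close> does not depend on \<open>n\<close>, the rate stays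
  positive.\<close>

lemma orthogonal_achievable_critical_load:
  fixes k :: "nat \<Rightarrow> nat"
  assumes N0: "N0 > 0" and k_pos: "\<And>n. k n > 0"
    and k: "(\<lambda>n. real (k n)) \<in> O(\<lambda>n. real n / log 2 (real n))"
  shows "\<exists>R>0. orthogonal_achievable N0 k R"
proof -
  obtain c where c: "c > 0" and ev: "\<forall>\<^sub>F n in sequentially. norm (real (k n)) \<le> c * norm (real n / log 2 (real n))"
    using landau_o.bigE[OF k] by blast
  note ev
  moreover have "\<forall>\<^sub>F n in sequentially. real n / log 2 (real n) \<ge> 0" by real_asymp
  ultimately have k_le: "\<forall>\<^sub>F n in sequentially. real (k n) \<le> c * (real n / log 2 (real n))"
    by eventually_elim (simp only: real_norm_def abs_of_nonneg of_nat_0_le_iff)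
  define \<beta> where "\<beta> = c * ln 2 + 1"
  have \<beta>: "\<beta> > c * ln 2" "\<beta> > 0" using c by (simp_all add: \<beta>_def add_pos_pos)
  \<comment> \<open>With \<open>\<theta> = \<eta> = 1/4\<close> the two exponents become
    \<open>\<beta> + 1\<close> and \<open>4 * (\<beta> + 1)\<close>, and
    \<open>\<gamma> = 1/64\<close> respects the sign code limit \<open>1/32\<close>.\<close>
  define \<tau> where "\<tau> = 16 * N0 * (\<beta> + 1)"
  have \<tau>: "\<tau> > 0" using N0 \<beta> by (simp add: \<tau>_def)
  have "orthogonal_achievable N0 k (1/64 * log 2 (exp 1) / \<tau>)"
  proof (rule orthogonal_achievableI[OF N0 \<tau>, where \<theta> = "1/4" and \<eta> = "1/4" and \<beta> = \<beta>])
    show "\<beta> \<le> (1/4)\<^sup>2 * \<tau> / N0" "\<beta> \<le> (1 - 1/4 - 1/4)\<^sup>2 * \<tau> / N0 - 1/64"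
      using N0 \<beta>(2) by (simp_all add: \<tau>_def power2_eq_square field_simps)
  qed (use blocks_grow[OF c k_pos k_le] \<beta> in \<open>auto simp: power2_eq_square\<close>)
  moreover have "1/64 * log 2 (exp 1) / \<tau> > 0" using \<tau> by simp
  ultimately show ?thesis by blast
qed

section \<open>Converse bounds\<close>

lemma sum_PiE_two_coordinates_eq_0:
  fixes f h :: "'a \<Rightarrow> real"
  assumes "finite I" "finite A" "i \<in> I" "l \<in> I" "i \<noteq> l" "(\<Sum>v\<in>A. f v) = 0"
  shows "(\<Sum>w\<in>PiE I (\<lambda>_. A). f (w i) * h (w l)) = 0"
proof -
  \<comment> \<open>Padding the other coordinates with the factor 1 turns the sum into a product
    over coordinates; the factor of \<open>i\<close> is the vanishing sum of
    \<open>f\<close>.\<close>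
  let ?c = "\<lambda>t v. (if t = i then f v else 1) * (if t = l then h v else 1)"
  have "(\<Sum>w\<in>PiE I (\<lambda>_. A). f (w i) * h (w l)) = (\<Sum>w\<in>PiE I (\<lambda>_. A). \<Prod>t\<in>I. ?c t (w t))"
    using assms by (simp add: prod.distrib)
  also have "\<dots> = (\<Prod>t\<in>I. \<Sum>v\<in>A. ?c t v)"
    using assms by (subst prod_sum_PiE) auto
  also have "\<dots> = 0"
    using assms by (intro prod_zero) (auto intro!: bexI[of _ i])
  finally show ?thesis .
qed

text \<open>A marginal of the uniform law is uniform. The factor \<open>card A\<close> on the left
  avoids the exponent \<open>card I - 1\<close>.\<close>

lemma sum_PiE_one_coordinate:
  fixes f :: "'a \<Rightarrow> real"
  assumes "finite I" "finite A" "i \<in> I"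
  shows "real (card A) * (\<Sum>w\<in>PiE I (\<lambda>_. A). f (w i)) = real (card A) ^ card I * (\<Sum>v\<in>A. f v)"
proof -
  let ?c = "\<lambda>t v. if t = i then f v else 1"
  have "(\<Sum>w\<in>PiE I (\<lambda>_. A). f (w i)) = (\<Sum>w\<in>PiE I (\<lambda>_. A). \<Prod>t\<in>I. ?c t (w t))"
    using assms by simp
  also have "\<dots> = (\<Prod>t\<in>I. \<Sum>v\<in>A. ?c t v)"
    using assms by (subst prod_sum_PiE) auto
  also have "\<dots> = (\<Sum>v\<in>A. f v) * (\<Prod>t\<in>I - {i}. real (card A))"
    using assms by (subst prod.remove[OF assms(1,3)]) simp
  also have "(\<Prod>t\<in>I - {i}. real (card A)) = real (card A) ^ (card I - 1)"
    using assms by simp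
  finally show ?thesis
    using assms by (cases "card I") (auto simp: card_eq_0_iff)
qed

text \<open>Multiplied-out form of: the variance of a sum of independent terms is the sum of their
  variances, each at most a second moment. It is applied to each coordinate of the signal of random
  messages.\<close>

lemma sum_PiE_square_deviation_le:
  fixes y :: "'i \<Rightarrow> 'a \<Rightarrow> real"
  assumes "finite I" "finite A" "A \<noteq> {}"
  defines "\<mu> i \<equiv> (\<Sum>v\<in>A. y i v) / card A"
  shows "real (card A) * (\<Sum>w\<in>PiE I (\<lambda>_. A). ((\<Sum>i\<in>I. y i (w i)) - (\<Sum>i\<in>I. \<mu> i))\<^sup>2)
    \<le> real (card A) ^ card I * (\<Sum>i\<in>I. \<Sum>v\<in>A. (y i v)\<^sup>2)"
proof -
  define b where "b i v = y i v - \<mu> i" for i v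
  let ?W = "PiE I (\<lambda>_. A)"
  have cA: "real (card A) > 0" using assms by (simp add: card_gt_0_iff)
  have mean: "card A * \<mu> i = (\<Sum>v\<in>A. y i v)" for i using cA by (simp add: \<mu>_def)
  have b0: "(\<Sum>v\<in>A. b i v) = 0" for i
    using mean[of i] by (simp add: b_def sum_subtractf)
  have "(\<Sum>w\<in>?W. ((\<Sum>i\<in>I. y i (w i)) - (\<Sum>i\<in>I. \<mu> i))\<^sup>2) = (\<Sum>w\<in>?W. \<Sum>i\<in>I. \<Sum>l\<in>I. b i (w i) * b l (w l))"
    by (simp add: b_def power2_eq_square sum_product flip: sum_subtractf)
  also have "\<dots> = (\<Sum>i\<in>I. \<Sum>l\<in>I. \<Sum>w\<in>?W. b i (w i) * b l (w l))"
    by (subst sum.swap, rule sum.cong[OF refl], rule sum.swap)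
  \<comment> \<open>Centred terms of distinct coordinates are uncorrelated.\<close>
  also have "\<dots> = (\<Sum>i\<in>I. \<Sum>l\<in>I. if l = i then \<Sum>w\<in>?W. (b i (w i))\<^sup>2 else 0)"
    using sum_PiE_two_coordinates_eq_0[OF assms(1,2) _ _ _ b0]
    by (intro sum.cong refl) (auto simp: power2_eq_square)
  also have "\<dots> = (\<Sum>i\<in>I. \<Sum>w\<in>?W. (b i (w i))\<^sup>2)"
    using assms(1) by simp
  finally have "card A * (\<Sum>w\<in>?W. ((\<Sum>i\<in>I. y i (w i)) - (\<Sum>i\<in>I. \<mu> i))\<^sup>2)
      = (\<Sum>i\<in>I. card A * (\<Sum>w\<in>?W. (b i (w i))\<^sup>2))"
    by (simp add: sum_distrib_left)
  also have "\<dots> = real (card A) ^ card I * (\<Sum>i\<in>I. \<Sum>v\<in>A. (b i v)\<^sup>2)"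
    unfolding sum_distrib_left[of "real (card A) ^ card I" _ I]
    using assms(1,2) by (intro sum.cong refl sum_PiE_one_coordinate)
  also have "\<dots> \<le> real (card A) ^ card I * (\<Sum>i\<in>I. \<Sum>v\<in>A. (y i v)\<^sup>2)"
  proof (rule mult_left_mono, rule sum_mono)
    fix i
    have "(\<Sum>v\<in>A. (b i v)\<^sup>2) = (\<Sum>v\<in>A. (y i v)\<^sup>2) - 2 * \<mu> i * (\<Sum>v\<in>A. y i v) + card A * (\<mu> i)\<^sup>2"
      by (simp add: b_def power2_diff sum.distrib sum_subtractf sum_distrib_left mult_ac)
    also have "\<dots> = (\<Sum>v\<in>A. (y i v)\<^sup>2) - card A * (\<mu> i)\<^sup>2"
      by (simp add: mean[symmetric] power2_eq_square)
    finally show "(\<Sum>v\<in>A. (b i v)\<^sup>2) \<le> (\<Sum>v\<in>A. (y i v)\<^sup>2)" by simp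
  qed simp
  finally show ?thesis .
qed

section \<open>Converse bounds for one code at one blocklength\<close>

locale gaussian_mac_code =
  fixes N0 :: real and k n M :: nat and E \<epsilon> :: real and x :: encoders and g :: decoder
  assumes N0: "N0 > 0" and code: "symmetric_code N0 k n M E \<epsilon> x g"
begin

definition signal :: "(nat \<Rightarrow> nat) \<Rightarrow> nat \<Rightarrow> real" where
  "signal w j = (\<Sum>i<k. x i (w i) j)"

definition output_measure :: "(nat \<Rightarrow> nat) \<Rightarrow> (nat \<Rightarrow> real) measure" where
  "output_measure w = PiM {..<n} (\<lambda>j. gaussian (signal w j) (sqrt (N0 / 2)))"

definition decode_region :: "(nat \<Rightarrow> nat) \<Rightarrow> (nat \<Rightarrow> real) set" where
  "decode_region w = {y \<in> space (\<Pi>\<^sub>M j\<in>{..<n}. borel). \<forall>i<k. g y i = w i}"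

abbreviation "messages \<equiv> PiE {..<k} (\<lambda>_. {1..M})"

lemma M_ge_1: "M \<ge> 1"
  and energy: "i < k \<Longrightarrow> v \<in> {1..M} \<Longrightarrow> (\<Sum>j<n. (x i v j)\<^sup>2) \<le> E"
  and decoder_measurable: "g \<in> (\<Pi>\<^sub>M j\<in>{..<n}. borel) \<rightarrow>\<^sub>M (\<Pi>\<^sub>M i\<in>{..<k}. count_space {1..M})"
  and error_le: "joint_error_prob N0 n k M x g \<le> \<epsilon>"
  using code by (auto simp: symmetric_code_def)

lemma finite_messages: "finite messages"
  by (intro finite_PiE) auto

lemma card_messages: "card messages = M ^ k"
  by (simp add: card_PiE)

declare finite_messages [simplified, simp] card_messages [simplified, simp]

lemma decode_region_sets [measurable]: "decode_region w \<in> sets (\<Pi>\<^sub>M j\<in>{..<n}. borel)"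
proof -
  let ?Y = "\<Pi>\<^sub>M j\<in>{..<n}. (borel :: real measure)"
  have "{y \<in> space ?Y. g y i \<noteq> w i} \<in> sets ?Y" if "i < k" for i
    using measurable_decoder_eq[OF decoder_measurable that] by measurable
  then have "space ?Y - (\<Union>i\<in>{..<k}. {y \<in> space ?Y. g y i \<noteq> w i}) \<in> sets ?Y"
    by (intro sets.compl_sets sets.finite_UN) auto
  also have "space ?Y - (\<Union>i\<in>{..<k}. {y \<in> space ?Y. g y i \<noteq> w i}) = decode_region w"
    by (auto simp: decode_region_def)
  finally show ?thesis .
qed

lemma disjoint_decode_regions: "disjoint_family_on decode_region messages"
proof (unfold disjoint_family_on_def, intro ballI impI equals0I)
  fix w w' y assume w: "w \<in> messages" "w' \<in> messages" "w \<noteq> w'" and "y \<in> decode_region w \<inter> decode_region w'"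
  then have "\<forall>i<k. w i = w' i" by (auto simp: decode_region_def)
  with w(1,2) have "w = w'" by (intro PiE_ext[OF w(1,2)]) auto
  with w(3) show False by simp
qed

text \<open>The regions are disjoint, so a single output law cannot favour many message vectors at
  once. This caps the last term of the divergence inequality after summation.\<close>

lemma sum_decode_regions_le_1:
  assumes "prob_space Q" "sets Q = sets (\<Pi>\<^sub>M j\<in>{..<n}. borel)" and "W \<subseteq> messages"
  shows "(\<Sum>w\<in>W. measure Q (decode_region w)) \<le> 1"
proof -
  interpret prob_space Q by fact
  have "finite W" using assms(3) finite_messages by (rule finite_subset)
  then have "(\<Sum>w\<in>W. measure Q (decode_region w)) = measure Q (\<Union>w\<in>W. decode_region w)"
  proof (rule finite_measure_finite_Union[symmetric])
    show "decode_region ` W \<subseteq> sets Q" unfolding assms(2) using decode_region_sets by (rule image_subsetI)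
    show "disjoint_family_on decode_region W"
      using assms(3) disjoint_decode_regions by (rule disjoint_family_on_mono)
  qed
  then show ?thesis by simp
qed

lemma sets_output_measure: "sets (PiM {..<n} (\<lambda>j. gaussian (m j) s)) = sets (\<Pi>\<^sub>M j\<in>{..<n}. borel)"
  by (intro sets_PiM_cong) auto

lemma prob_space_output_measure: "prob_space (output_measure w)"
  unfolding output_measure_def using N0 by (intro prob_space_PiM_gaussian) simp

text \<open>Given \<open>w\<close>, the output has law \<open>output_measure w\<close>, so the
  conditional error is the mass outside the decode region; its average over \<open>w\<close> is at
  most \<open>\<epsilon>\<close>.\<close>

lemma sum_correct_ge:
  "(\<Sum>w\<in>messages. measure (output_measure w) (decode_region w)) \<ge> (1 - \<epsilon>) * real M ^ k"
proof -
  let ?N = "noise_measure N0 n"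
  interpret prob_space ?N using N0 by (rule prob_space_noise_measure)
  have eq: "measure ?N {z \<in> space ?N. \<exists>i<k. g (channel_output n k x w z) i \<noteq> w i}
      = 1 - measure (output_measure w) (decode_region w)" for w
  proof -
    have out: "channel_output n k x w = (\<lambda>z. \<lambda>j\<in>{..<n}. signal w j + z j)"
      by (simp add: channel_output_def signal_def fun_eq_iff)
    have dist: "output_measure w = distr ?N (\<Pi>\<^sub>M j\<in>{..<n}. borel) (channel_output n k x w)"
      unfolding output_measure_def out using distr_noise_shift[OF N0] by simp
    have "channel_output n k x w -` decode_region w \<inter> space ?N \<in> sets ?N"
      using channel_output_measurable decode_region_sets by (rule measurable_sets)
    then have "measure ?N (space ?N - (channel_output n k x w -` decode_region w \<inter> space ?N))
        = 1 - measure ?N (channel_output n k x w -` decode_region w \<inter> space ?N)"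
      by (rule prob_compl)
    moreover have "measure (output_measure w) (decode_region w) = measure ?N (channel_output n k x w -` decode_region w \<inter> space ?N)"
      unfolding dist using channel_output_measurable decode_region_sets by (rule measure_distr)
    moreover have "{z \<in> space ?N. \<exists>i<k. g (channel_output n k x w z) i \<noteq> w i}
        = space ?N - (channel_output n k x w -` decode_region w \<inter> space ?N)"
      using measurable_space[OF channel_output_measurable, of _ N0 n k x w] by (auto simp: decode_region_def)
    ultimately show ?thesis by simp
  qed
  have "(\<Sum>w\<in>messages. 1 - measure (output_measure w) (decode_region w)) / real M ^ k \<le> \<epsilon>"
    using error_le unfolding joint_error_prob_eq[OF N0 M_ge_1 decoder_measurable] eq .
  then have "real M ^ k - (\<Sum>w\<in>messages. measure (output_measure w) (decode_region w)) \<le> \<epsilon> * real M ^ k"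
    using M_ge_1 by (simp add: sum_subtractf pos_divide_le_eq)
  then show ?thesis by (simp add: algebra_simps)
qed

text \<open>
  The \<open>k\<close> message vectors obtained from \<open>w\<close> by cyclically shifting a single entry have
  signals within distance \<open>2 \<surd>E\<close> of that of \<open>w\<close>. Telling them apart takes energy of
  order \<open>ln k\<close>.
\<close>

lemma energy_lower_bound:
  assumes "M \<ge> 2" "k \<ge> 1"
  shows "(1 - \<epsilon>) * ln (real k) \<le> 4 * E / N0 + 1"
proof -
  \<comment> \<open>Cyclic shift: a permutation of the messages, without fixed points because
    \<open>M \<ge> 2\<close>.\<close>
  define s where "s v = (if v = M then 1 else Suc v)" for v
  define T where "T i w = w(i := s (w i))" for i and w :: "nat \<Rightarrow> nat"
  define p where "p w = measure (output_measure w) (decode_region w)" for w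
  have s_mem: "s v \<in> {1..M}" if "v \<in> {1..M}" for v using that by (auto simp: s_def)
  have s_ne: "s v \<noteq> v" if "v \<in> {1..M}" for v using that assms by (auto simp: s_def)
  have s_inj: "v = v'" if "s v = s v'" "v \<in> {1..M}" "v' \<in> {1..M}" for v v'
    using that by (cases "v = M"; cases "v' = M") (simp_all add: s_def)
  have T_bij: "bij_betw (T i) messages messages" if i: "i < k" for i
  proof -
    have maps: "T i w \<in> messages" if w: "w \<in> messages" for w
    proof (rule PiE_I)
      show "T i w l \<in> {1..M}" if "l \<in> {..<k}" for l
        using that PiE_mem[OF w, of l] s_mem[of "w l"] by (cases "l = i") (simp_all add: T_def)
      show "T i w l = undefined" if "l \<notin> {..<k}" for l
      proof -
        have "l \<noteq> i" using that i by blast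
        then show ?thesis using PiE_arb[OF w that] by (simp add: T_def)
      qed
    qed
    have inj: "inj_on (T i) messages"
    proof (rule inj_onI)
      fix w w' assume w: "w \<in> messages" "w' \<in> messages" and eq: "T i w = T i w'"
      have "w i \<in> {1..M}" "w' i \<in> {1..M}" using PiE_mem[OF w(1), of i] PiE_mem[OF w(2), of i] i by simp_all
      moreover have "s (w i) = s (w' i)" using fun_cong[OF eq, of i] by (simp add: T_def)
      ultimately have "w i = w' i" using s_inj by blast
      moreover have "w l = w' l" if "l \<noteq> i" for l using fun_cong[OF eq, of l] that by (simp add: T_def)
      ultimately show "w = w'" by (intro ext) metis
    qed
    have "T i ` messages \<subseteq> messages" using maps by (rule image_subsetI)
    from inj endo_inj_surj[OF finite_messages this inj] show ?thesis by (rule bij_betw_imageI)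
  qed
  \<comment> \<open>Divergence inequality from each shifted vector to the common \<open>w\<close>,
    with \<open>L = k\<close>: the \<open>k\<close> regions are disjoint, so the last terms add up
    to at most \<open>k\<close>.\<close>
  have pointwise: "(\<Sum>i<k. p (T i w) * ln (real k)) \<le> real k * (4 * E / N0) + real k"
    if w: "w \<in> messages" for w
  proof -
    have wM: "w i \<in> {1..M}" if "i < k" for i using PiE_mem[OF w] that by simp
    have "p (T i w) * ln (real k) \<le> 4 * E / N0 + real k * measure (output_measure w) (decode_region (T i w))"
      if i: "i < k" for i
    proof -
      have diff: "signal (T i w) j - signal w j = x i (s (w i)) j - x i (w i) j" for j
      proof -
        have "signal (T i w) j - signal w j = (\<Sum>l<k. if l = i then x i (s (w i)) j - x i (w i) j else 0)"
          unfolding signal_def by (subst sum_subtractf[symmetric], rule sum.cong) (auto simp: T_def)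
        then show ?thesis using i by simp
      qed
      have "(\<Sum>j<n. (signal (T i w) j - signal w j)\<^sup>2) \<le> (\<Sum>j<n. 2 * (x i (s (w i)) j)\<^sup>2 + 2 * (x i (w i) j)\<^sup>2)"
      proof (rule sum_mono)
        fix j
        have "(a - b)\<^sup>2 \<le> 2 * a\<^sup>2 + 2 * b\<^sup>2" for a b :: real
          using zero_le_power2[of "a + b"] by (simp add: power2_eq_square algebra_simps)
        then show "(signal (T i w) j - signal w j)\<^sup>2 \<le> 2 * (x i (s (w i)) j)\<^sup>2 + 2 * (x i (w i) j)\<^sup>2"
          unfolding diff .
      qed
      also have "\<dots> \<le> 4 * E"
        using energy[OF i wM[OF i]] energy[OF i s_mem[OF wM[OF i]]]
        by (simp add: sum.distrib flip: sum_distrib_left)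
      finally have d: "(\<Sum>j<n. (signal (T i w) j - signal w j)\<^sup>2) \<le> 4 * E" .
      have "p (T i w) * ln (real k) \<le> real n * ln (sqrt (N0 / 2) / sqrt (N0 / 2))
          + (real n * (sqrt (N0 / 2))\<^sup>2 + (\<Sum>j<n. (signal (T i w) j - signal w j)\<^sup>2)) / (2 * (sqrt (N0 / 2))\<^sup>2)
          - real n / 2 + real k * measure (output_measure w) (decode_region (T i w))"
        unfolding p_def output_measure_def
        using N0 \<open>k \<ge> 1\<close> by (intro gaussian_measure_le_divergence decode_region_sets) auto
      \<comment> \<open>Equal variances: the logarithm vanishes and \<open>n / 2\<close> cancels,
        leaving the squared distance over \<open>N0\<close>.\<close>
      also have "\<dots> = (\<Sum>j<n. (signal (T i w) j - signal w j)\<^sup>2) / N0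
          + real k * measure (output_measure w) (decode_region (T i w))"
        using N0 by (simp add: add_divide_distrib)
      also have "\<dots> \<le> 4 * E / N0 + real k * measure (output_measure w) (decode_region (T i w))"
        using divide_right_mono[OF d, of N0] N0 by simp
      finally show ?thesis .
    qed
    then have "(\<Sum>i<k. p (T i w) * ln (real k))
        \<le> (\<Sum>i<k. 4 * E / N0 + real k * measure (output_measure w) (decode_region (T i w)))"
      by (intro sum_mono) auto
    also have "\<dots> = real k * (4 * E / N0) + real k * (\<Sum>i<k. measure (output_measure w) (decode_region (T i w)))"
      by (simp add: sum.distrib flip: sum_distrib_left)
    also have "(\<Sum>i<k. measure (output_measure w) (decode_region (T i w))) \<le> 1"
    proof -
      \<comment> \<open>The shift moves every entry, so \<open>T i w\<close> reveals
        \<open>i\<close>.\<close>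
      have inj: "inj_on (\<lambda>i. T i w) {..<k}"
      proof (rule inj_onI)
        fix i l assume "i \<in> {..<k}" "T i w = T l w"
        then have "T l w i \<noteq> w i" using s_ne wM by (metis T_def fun_upd_same lessThan_iff)
        then show "i = l" by (auto simp: T_def split: if_splits)
      qed
      have "(\<lambda>i. T i w) ` {..<k} \<subseteq> messages"
        using T_bij w by (auto simp: bij_betw_def)
      then have "(\<Sum>w'\<in>(\<lambda>i. T i w) ` {..<k}. measure (output_measure w) (decode_region w')) \<le> 1"
        by (intro sum_decode_regions_le_1 prob_space_output_measure) (simp_all add: output_measure_def sets_output_measure)
      then show ?thesis using inj by (simp add: sum.reindex)
    qed
    finally show ?thesis by (simp add: mult_left_mono)
  qed
  have "real k * ((1 - \<epsilon>) * real M ^ k * ln (real k)) \<le> real k * ((\<Sum>w\<in>messages. p w) * ln (real k))"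
    using sum_correct_ge \<open>k \<ge> 1\<close> by (intro mult_left_mono mult_right_mono) (auto simp: p_def)
  \<comment> \<open>Each \<open>T i\<close> permutes the message vectors, so shifting them does not
    change the summed success probability.\<close>
  also have "\<dots> = (\<Sum>i<k. (\<Sum>w\<in>messages. p (T i w)) * ln (real k))"
    using sum.reindex_bij_betw[OF T_bij, of _ p] by simp
  also have "\<dots> = (\<Sum>w\<in>messages. \<Sum>i<k. p (T i w) * ln (real k))"
    by (subst sum.swap) (simp add: sum_distrib_right)
  also have "\<dots> \<le> (\<Sum>w\<in>messages. real k * (4 * E / N0) + real k)"
    by (intro sum_mono pointwise)
  also have "\<dots> = real k * (real M ^ k * (4 * E / N0 + 1))"
    by (simp add: algebra_simps)
  finally have "real M ^ k * ((1 - \<epsilon>) * ln (real k)) \<le> real M ^ k * (4 * E / N0 + 1)"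
    using \<open>k \<ge> 1\<close> by (simp add: mult_ac)
  then show ?thesis using M_ge_1 by simp
qed

text \<open>All output laws are compared with one Gaussian vector \<open>Q\<close>, centred at the
  average signal, with the variance raised by the total power \<open>P\<close>; \<open>L\<close> is
  the number of message vectors. The squared deviation averages to at most \<open>k * E\<close>, so
  the quadratic term stays within \<open>n / 2\<close> and \<open>n * ln (s' / s)\<close>
  survives.\<close>

lemma sum_rate_upper_bound:
  assumes "n \<ge> 1" "E > 0"
  shows "(1 - \<epsilon>) * (real k * ln (real M)) \<le> real n / 2 * ln (1 + 2 * real k * E / (real n * N0)) + 1"
proof -
  define P where "P = real k * E / real n"
  define s where "s = sqrt (N0 / 2)"
  define s' where "s' = sqrt (N0 / 2 + P)"
  define \<mu> where "\<mu> j = (\<Sum>i<k. (\<Sum>v\<in>{1..M}. x i v j) / real M)" for j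
  define Q where "Q = PiM {..<n} (\<lambda>j. gaussian (\<mu> j) s')"
  let ?L = "real M ^ k"
  have P: "P \<ge> 0" using assms by (simp add: P_def)
  have s: "s > 0" "s\<^sup>2 = N0 / 2" "s' > 0" "s'\<^sup>2 = N0 / 2 + P" using N0 P by (simp_all add: s_def s'_def)
  have L: "?L \<ge> 1" using M_ge_1 by simp
  have dev: "(\<Sum>w\<in>messages. \<Sum>j<n. (signal w j - \<mu> j)\<^sup>2) \<le> ?L * (real k * E)"
  proof -
    have "real M * (\<Sum>w\<in>messages. \<Sum>j<n. (signal w j - \<mu> j)\<^sup>2)
        = (\<Sum>j<n. real M * (\<Sum>w\<in>messages. (signal w j - \<mu> j)\<^sup>2))"
      by (subst sum.swap) (simp add: sum_distrib_left)
    also have "\<dots> \<le> (\<Sum>j<n. ?L * (\<Sum>i<k. \<Sum>v\<in>{1..M}. (x i v j)\<^sup>2))"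
      using sum_PiE_square_deviation_le[of "{..<k}" "{1..M}" "\<lambda>i v. x i v _"] M_ge_1
      by (intro sum_mono) (simp add: signal_def \<mu>_def)
    also have "\<dots> = ?L * (\<Sum>i<k. \<Sum>v\<in>{1..M}. \<Sum>j<n. (x i v j)\<^sup>2)"
      unfolding sum_distrib_left[symmetric]
      by (subst sum.swap, rule arg_cong[where f = "(*) _"], rule sum.cong[OF refl], rule sum.swap)
    also have "\<dots> \<le> ?L * (\<Sum>i<k. \<Sum>v\<in>{1..M}. E)"
      using L by (intro mult_left_mono sum_mono energy) auto
    also have "\<dots> = real M * (?L * (real k * E))" by simp
    finally show ?thesis using M_ge_1 by simp
  qed
  have "(\<Sum>w\<in>messages. measure (output_measure w) (decode_region w)) * ln ?L
      \<le> (\<Sum>w\<in>messages. real n * ln (s' / s) + (real n * s\<^sup>2 + (\<Sum>j<n. (signal w j - \<mu> j)\<^sup>2)) / (2 * s'\<^sup>2)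
          - real n / 2 + ?L * measure Q (decode_region w))"
    unfolding sum_distrib_right output_measure_def Q_def s_def[symmetric]
    by (intro sum_mono gaussian_measure_le_divergence decode_region_sets s L)
  also have "\<dots> = ?L * (real n * ln (s' / s) - real n / 2) + (?L * (real n * s\<^sup>2)
      + (\<Sum>w\<in>messages. \<Sum>j<n. (signal w j - \<mu> j)\<^sup>2)) / (2 * s'\<^sup>2) + ?L * (\<Sum>w\<in>messages. measure Q (decode_region w))"
    by (simp add: sum.distrib sum_subtractf sum_distrib_left algebra_simps flip: sum_divide_distrib)
  also have "\<dots> \<le> ?L * (real n * ln (s' / s) - real n / 2) + (?L * (real n * s\<^sup>2) + ?L * (real k * E)) / (2 * s'\<^sup>2) + ?L * 1"
    using s(1,3) L dev sum_decode_regions_le_1[of Q messages]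
    by (intro add_mono divide_right_mono mult_left_mono order_refl)
      (auto simp: Q_def sets_output_measure prob_space_PiM_gaussian)
  also have "\<dots> = ?L * (real n * ln (s' / s) - real n / 2 + (real n * s\<^sup>2 + real k * E) / (2 * s'\<^sup>2) + 1)"
    by (simp add: algebra_simps add_divide_distrib)
  also have "(real n * s\<^sup>2 + real k * E) / (2 * s'\<^sup>2) = real n / 2"
  proof -
    have "real n * s\<^sup>2 + real k * E = real n * s'\<^sup>2" unfolding s(2,4) P_def using assms by (simp add: field_simps)
    then show ?thesis using s(3) by simp
  qed
  finally have 1: "(\<Sum>w\<in>messages. measure (output_measure w) (decode_region w)) * ln ?L \<le> ?L * (real n * ln (s' / s) + 1)"
    by simp
  have "?L * ((1 - \<epsilon>) * ln ?L) \<le> (\<Sum>w\<in>messages. measure (output_measure w) (decode_region w)) * ln ?L"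
    using mult_right_mono[OF sum_correct_ge, of "ln ?L"] L by (simp add: mult_ac)
  with 1 have "?L * ((1 - \<epsilon>) * ln ?L) \<le> ?L * (real n * ln (s' / s) + 1)" by linarith
  then have "(1 - \<epsilon>) * ln ?L \<le> real n * ln (s' / s) + 1" using L M_ge_1 by simp
  also have "ln (s' / s) = ln ((s' / s)\<^sup>2) / 2" using s by (simp add: ln_realpow)
  also have "(s' / s)\<^sup>2 = 1 + 2 * real k * E / (real n * N0)"
    unfolding power_divide s(2,4) P_def using N0 assms by (simp add: field_simps)
  finally show ?thesis using M_ge_1 by (simp add: ln_realpow)
qed

end

section \<open>Capacity\<close>

text \<open>The quotient is the slope of the chord of \<open>ln\<close> starting at 1, which
  concavity makes nonincreasing.\<close>

lemma ln_one_plus_over_antimono: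
  fixes u v :: real
  assumes "0 < u" "u \<le> v"
  shows "ln (1 + v) / v \<le> ln (1 + u) / u"
proof -
  have "(1 - u / v) * ln 1 + u / v * ln (1 + v) \<le> ln ((1 - u / v) *\<^sub>R 1 + (u / v) *\<^sub>R (1 + v))"
    using assms by (intro concave_onD[OF ln_concave]) auto
  also have "(1 - u / v) *\<^sub>R 1 + (u / v) *\<^sub>R (1 + v) = 1 + u"
    using assms by (simp add: field_simps)
  finally show ?thesis using assms by (simp add: field_simps)
qed

text \<open>The energy bound yields \<open>u \<le> U\<close>. Dividing the sum rate bound by
  \<open>n * U / 2\<close> gives \<open>ln (1 + U) / U + 2 / (n * U)\<close>, where both terms can
  only grow when \<open>U\<close> is replaced by \<open>u\<close>.\<close>

lemma rate_bound_of_code: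
  fixes k n M :: nat and E \<rho> u \<epsilon> :: real
  assumes "N0 > 0" and code: "symmetric_code N0 k n M E \<epsilon> x g" and "n \<ge> 1" "E > 0" "k \<ge> 1" and \<epsilon>: "\<epsilon> \<le> 1 / 2"
    and \<rho>: "0 < \<rho>" "\<rho> < log 2 (real M) / E"
    and u: "0 < u" "u \<le> real k / (2 * real n) * (ln (real k) / 2 - 1)"
  shows "(1 - \<epsilon>) * ln 2 * \<rho> * N0 \<le> ln (1 + u) / u + 2 / (real n * u)"
proof -
  interpret gaussian_mac_code N0 k n M E \<epsilon> x g using assms by unfold_locales
  define U where "U = 2 * real k * E / (real n * N0)"
  have "log 2 (real M) > 0" using \<rho> \<open>E > 0\<close> by (simp add: pos_less_divide_eq) (meson less_trans mult_pos_pos)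
  \<comment> \<open>A positive rate forces two messages, as the energy bound requires.\<close>
  then have M: "M \<ge> 2" by (metis M_ge_1 Suc_1 le_antisym log_one not_less_eq_eq of_nat_1 order_less_irrefl One_nat_def)
  have "1 / 2 * ln (real k) \<le> (1 - \<epsilon>) * ln (real k)"
    using \<epsilon> \<open>k \<ge> 1\<close> by (intro mult_right_mono) auto
  also have "\<dots> \<le> 4 * E / N0 + 1" using M \<open>k \<ge> 1\<close> by (rule energy_lower_bound)
  finally have E_ge: "ln (real k) / 2 - 1 \<le> 4 * E / N0" by simp
  have "u \<le> real k / (2 * real n) * (ln (real k) / 2 - 1)" by fact
  also have "\<dots> \<le> real k / (2 * real n) * (4 * E / N0)"
    using E_ge by (intro mult_left_mono) auto
  also have "\<dots> = U" by (simp add: U_def)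
  finally have U: "u \<le> U" .
  then have U_pos: "U > 0" using u by linarith
  have kE: "real k * E = U * real n * N0 / 2" using assms by (simp add: U_def)
  have "\<rho> * E * ln 2 \<le> log 2 (real M) * ln 2"
    using \<rho> \<open>E > 0\<close> by (intro mult_right_mono) (auto simp: pos_less_divide_eq)
  also have "\<dots> = ln (real M)" by (simp add: log_def)
  finally have "(1 - \<epsilon>) * (real k * (\<rho> * E * ln 2)) \<le> (1 - \<epsilon>) * (real k * ln (real M))"
    using \<epsilon> by (intro mult_left_mono) auto
  also have "\<dots> \<le> real n / 2 * ln (1 + U) + 1"
    unfolding U_def using \<open>n \<ge> 1\<close> \<open>E > 0\<close> by (rule sum_rate_upper_bound)
  also have "(1 - \<epsilon>) * (real k * (\<rho> * E * ln 2)) = ((1 - \<epsilon>) * ln 2 * \<rho> * N0) * (real n * U / 2)"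
    using kE by (simp add: mult_ac)
  finally have "(1 - \<epsilon>) * ln 2 * \<rho> * N0 \<le> (real n / 2 * ln (1 + U) + 1) / (real n * U / 2)"
    using U_pos \<open>n \<ge> 1\<close> by (subst pos_le_divide_eq) auto
  also have "\<dots> = ln (1 + U) / U + 2 / (real n * U)"
    using U_pos \<open>n \<ge> 1\<close> by (simp add: field_simps)
  also have "\<dots> \<le> ln (1 + u) / u + 2 / (real n * u)"
    using u U \<open>n \<ge> 1\<close> by (intro add_mono ln_one_plus_over_antimono divide_left_mono mult_left_mono) auto
  finally show ?thesis .
qed

text \<open>The bound for one code is used with error probability and rate slack both equal to
  \<open>t\<close>: first \<open>n\<close> grows, then \<open>t\<close> tends to 0.\<close>

lemma achievable_le_of_load_ge:
  fixes k :: "nat \<Rightarrow> nat"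
  assumes N0: "N0 > 0" and k_pos: "\<And>n. k n > 0" and "c > 0"
    and k_ge: "\<forall>\<^sub>F n in sequentially. c * (real n / log 2 (real n)) \<le> real (k n)"
    and ach: "achievable N0 k R"
  defines "u \<equiv> c * ln 2 / 16"
  shows "R \<le> ln (1 + u) / u / (N0 * ln 2)"
proof -
  have u: "u > 0" using \<open>c > 0\<close> by (simp add: u_def)
  define B where "B = ln (1 + u) / u"
  have B: "B \<ge> 0" using u by (simp add: B_def)
  \<comment> \<open>With the load \<open>r n\<close> in place of \<open>k n\<close> the right-hand
    side tends to \<open>c * ln 2 / 4\<close>, strictly above \<open>u\<close>. Once
    \<open>r n > exp 2\<close> the bracket is positive, so a larger load only increases the
    product.\<close>
  have u_le: "\<forall>\<^sub>F n in sequentially. u \<le> real (k n) / (2 * real n) * (ln (real (k n)) / 2 - 1)"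
  proof -
    define r where "r n = c * (real n / log 2 (real n))" for n
    have r_inf: "filterlim r at_top sequentially"
      unfolding r_def using \<open>c > 0\<close> by real_asymp
    have "(\<lambda>n. r n / (2 * real n) * (ln (r n) / 2 - 1)) \<longlonglongrightarrow> c * ln 2 / 4"
      unfolding r_def using \<open>c > 0\<close> by real_asymp
    moreover have "u < c * ln 2 / 4" using \<open>c > 0\<close> by (simp add: u_def)
    ultimately have "\<forall>\<^sub>F n in sequentially. u < r n / (2 * real n) * (ln (r n) / 2 - 1)"
      by (rule order_tendstoD(1))
    moreover have "\<forall>\<^sub>F n in sequentially. r n > exp 2"
      using r_inf by (simp add: filterlim_at_top_dense)
    ultimately show ?thesis using k_ge
    proof eventually_elim
      case (elim n)
      have r: "r n > 0" using elim(2) exp_gt_zero[of "2::real"] by linarith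
      have "ln (exp 2) < ln (r n)" using elim(2) r by (subst ln_less_cancel_iff) auto
      moreover have "ln (r n) \<le> ln (real (k n))" using r elim(3) by (subst ln_le_cancel_iff) (auto simp: r_def)
      ultimately have "r n / (2 * real n) * (ln (r n) / 2 - 1) \<le> real (k n) / (2 * real n) * (ln (real (k n)) / 2 - 1)"
        using elim(3) by (intro mult_mono divide_right_mono) (auto simp: r_def)
      then show ?case using elim(1) by linarith
    qed
  qed
  have step: "(1 - t) * ln 2 * (R - t) * N0 \<le> B" if t: "0 < t" "t < 1/2" for t
  \<comment> \<open>The bound for one code needs a positive rate; otherwise the left-hand side is at
    most 0.\<close>
  proof (cases "R - t > 0")
    case False
    then have "(1 - t) * ln 2 * (R - t) * N0 \<le> 0"
      using t N0 by (intro mult_nonpos_nonneg mult_nonneg_nonpos) auto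
    then show ?thesis using B by linarith
  next
    case True
    have "\<forall>\<^sub>F n in sequentially. \<exists>M E x g. E > 0 \<and> symmetric_code N0 (k n) n M E t x g \<and> log 2 (real M) / E > R - t"
      using ach t unfolding achievable_def eps_achievable_def eventually_sequentially by auto
    then have "\<forall>\<^sub>F n in sequentially. (1 - t) * ln 2 * (R - t) * N0 \<le> B + 2 / (real n * u)"
      using u_le eventually_ge_at_top[of 1]
    proof eventually_elim
      case (elim n)
      then obtain M E x g where c: "E > 0" "symmetric_code N0 (k n) n M E t x g" "R - t < log 2 (real M) / E" by blast
      have k1: "k n \<ge> 1" using k_pos[of n] by simp
      show ?case unfolding B_def
        using t by (intro rate_bound_of_code[OF N0 c(2) elim(3) c(1) k1 _ True c(3) u elim(2)]) simp
    qed
    moreover have "(\<lambda>n. B + 2 / (real n * u)) \<longlonglongrightarrow> B"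
      using u by real_asymp
    ultimately show ?thesis
      by (intro tendsto_lowerbound[of "\<lambda>n. B + 2 / (real n * u)" B sequentially]) auto
  qed
  have "((\<lambda>t. (1 - t) * ln 2 * (R - t) * N0) \<longlongrightarrow> (1 - 0) * ln 2 * (R - 0) * N0) (at_right 0)"
    by (intro tendsto_intros)
  moreover have "\<forall>\<^sub>F t in at_right 0. (1 - t) * ln 2 * (R - t) * N0 \<le> B"
    by (rule eventually_mono[OF eventually_at_right_real[of 0 "1/2"]]) (auto intro: step)
  ultimately have "(1 - 0) * ln 2 * (R - 0) * N0 \<le> B"
    by (rule tendsto_upperbound) simp
  then show ?thesis using N0 by (simp add: B_def[symmetric] pos_le_divide_eq mult_ac)
qed

text \<open>A single message with zero codewords is never decoded wrongly. This keeps the capacity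
  from being negative.\<close>

lemma achievable_0:
  assumes N0: "N0 > 0"
  shows "achievable N0 k 0"
proof -
  have "symmetric_code N0 (k n) n 1 1 \<epsilon> (\<lambda>_ _ _. 0) (\<lambda>_. \<lambda>i\<in>{..<k n}. 1)" if "\<epsilon> > 0" for \<epsilon> n
  proof -
    have meas: "(\<lambda>_. \<lambda>i\<in>{..<k n}. 1::nat) \<in> (\<Pi>\<^sub>M j\<in>{..<n}. (borel :: real measure)) \<rightarrow>\<^sub>M (\<Pi>\<^sub>M i\<in>{..<k n}. count_space {1..1})"
      by (intro measurable_restrict) auto
    have "{z \<in> space (noise_measure N0 n). \<exists>i<k n. (\<lambda>i\<in>{..<k n}. 1) i \<noteq> w i} = {}"
      if "w \<in> PiE {..<k n} (\<lambda>_. {1..1::nat})" for w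
      using PiE_mem[OF that] by simp
    then have "joint_error_prob N0 n (k n) 1 (\<lambda>_ _ _. 0) (\<lambda>_. \<lambda>i\<in>{..<k n}. 1) = 0"
      using joint_error_prob_eq[OF N0 order_refl meas, of "\<lambda>_ _ _. 0"] by simp
    then show ?thesis using meas that by (simp add: symmetric_code_def)
  qed
  then show ?thesis
    unfolding achievable_def eps_achievable_def
    by (intro allI impI exI[of _ 0] exI[of _ 1] exI conjI) auto
qed

text \<open>One \<open>u\<close> serves all achievable rates, so the strict inequality
  \<open>ln (1 + u) < u\<close> survives the supremum.\<close>

lemma capacity_critical_load_less:
  fixes k :: "nat \<Rightarrow> nat"
  assumes N0: "N0 > 0" and k_pos: "\<And>n. k n > 0"
    and k: "(\<lambda>n. real (k n)) \<in> \<Omega>(\<lambda>n. real n / log 2 (real n))"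
  shows "capacity N0 k < ereal (log 2 (exp 1) / N0)"
proof -
  obtain c where c: "c > 0" and ev: "\<forall>\<^sub>F n in sequentially. norm (real (k n)) \<ge> c * norm (real n / log 2 (real n))"
    using landau_omega.bigE[OF k] by blast
  note ev
  moreover have "\<forall>\<^sub>F n in sequentially. real n / log 2 (real n) \<ge> 0" by real_asymp
  ultimately have k_ge: "\<forall>\<^sub>F n in sequentially. c * (real n / log 2 (real n)) \<le> real (k n)"
    by eventually_elim (simp only: real_norm_def abs_of_nonneg of_nat_0_le_iff)
  define u where "u = c * ln 2 / 16"
  have u: "u > 0" using c by (simp add: u_def)
  have "capacity N0 k \<le> ereal (ln (1 + u) / u / (N0 * ln 2))"
    unfolding capacity_def
    using achievable_le_of_load_ge[OF N0 k_pos c k_ge] by (intro SUP_least) (simp add: u_def)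
  moreover have "ln (1 + u) / u / (N0 * ln 2) < 1 / (N0 * ln 2)"
    using u N0 ln_add_one_self_less_self[OF u] by (intro divide_strict_right_mono) (simp_all add: pos_divide_less_eq)
  moreover have "1 / (N0 * ln 2) = log 2 (exp 1) / N0" by (simp add: log_def mult.commute)
  ultimately show ?thesis by (metis ereal_less_le less_ereal.simps(1) order_le_less_trans)
qed

text \<open>The load eventually exceeds every multiple \<open>c\<close> of the critical one; letting
  \<open>c\<close> grow drives the rate bound to 0.\<close>

lemma capacity_overload_eq_0:
  fixes k :: "nat \<Rightarrow> nat"
  assumes N0: "N0 > 0" and k_pos: "\<And>n. k n > 0"
    and k: "(\<lambda>n. real (k n)) \<in> \<omega>(\<lambda>n. real n / log 2 (real n))"
  shows "capacity N0 k = 0"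
proof (rule antisym)
  have "R \<le> 0" if R: "achievable N0 k R" for R
  proof -
    have bound: "R \<le> ln (1 + c * ln 2 / 16) / (c * ln 2 / 16) / (N0 * ln 2)" if c: "c > 0" for c
    proof -
      have "\<forall>\<^sub>F n in sequentially. norm (real (k n)) \<ge> c * norm (real n / log 2 (real n))"
        using landau_omega.smallD[OF k c] .
      moreover have "\<forall>\<^sub>F n in sequentially. real n / log 2 (real n) \<ge> 0" by real_asymp
      ultimately have "\<forall>\<^sub>F n in sequentially. c * (real n / log 2 (real n)) \<le> real (k n)"
        by eventually_elim (simp only: real_norm_def abs_of_nonneg of_nat_0_le_iff)
      then show ?thesis using achievable_le_of_load_ge[OF N0 k_pos c _ R] by blast
    qed
    have "((\<lambda>c. ln (1 + c * ln 2 / 16) / (c * ln 2 / 16) / (N0 * ln 2)) \<longlongrightarrow> 0) at_top"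
      using N0 by real_asymp
    then show ?thesis
      by (rule tendsto_lowerbound) (use bound in \<open>auto intro: eventually_mono[OF eventually_gt_at_top[of 0]]\<close>)
  qed
  then show "capacity N0 k \<le> 0"
    unfolding capacity_def by (intro SUP_least) auto
  show "0 \<le> capacity N0 k"
    unfolding capacity_def using achievable_0[OF N0, of k] by (intro SUP_upper2[of 0]) auto
qed

lemma capacity_critical_load_pos:
  fixes k :: "nat \<Rightarrow> nat"
  assumes "N0 > 0" "\<And>n. k n > 0" "(\<lambda>n. real (k n)) \<in> O(\<lambda>n. real n / log 2 (real n))"
  shows "0 < capacity N0 k"
proof -
  obtain R where R: "R > 0" "orthogonal_achievable N0 k R"
    using orthogonal_achievable_critical_load[of N0 k, OF assms] by blast
  have "ereal R \<le> capacity N0 k"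
    unfolding capacity_def using orthogonal_achievable_imp_achievable[OF R(2)] by (intro SUP_upper) simp
  then show ?thesis using R(1) by (metis ereal_less(2) less_le_trans)
qed

theorem theorem1:
  fixes N0 :: real and k :: "nat \<Rightarrow> nat"
  assumes "N0 > 0" and "\<And>n. k n > 0"
  shows "((\<lambda>n. real (k n)) \<in> o(\<lambda>n. real n / log 2 (real n)) \<longrightarrow>
            (\<forall>R. R < log 2 (exp 1) / N0 \<longrightarrow>
               achievable N0 k R \<and> orthogonal_achievable N0 k R)) \<and>
         ((\<lambda>n. real (k n)) \<in> \<omega>(\<lambda>n. real n / log 2 (real n)) \<longrightarrow>
            capacity N0 k = 0) \<and>
         ((\<lambda>n. real (k n)) \<in> \<Theta>(\<lambda>n. real n / log 2 (real n)) \<longrightarrow>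
            0 < capacity N0 k \<and> capacity N0 k < ereal (log 2 (exp 1) / N0))"
proof (intro conjI impI allI)
  fix R assume "(\<lambda>n. real (k n)) \<in> o(\<lambda>n. real n / log 2 (real n))" "R < log 2 (exp 1) / N0"
  then show "orthogonal_achievable N0 k R"
    by (rule orthogonal_achievable_small_load[of N0 k, OF assms])
  then show "achievable N0 k R" by (rule orthogonal_achievable_imp_achievable)
next
  assume "(\<lambda>n. real (k n)) \<in> \<omega>(\<lambda>n. real n / log 2 (real n))"
  then show "capacity N0 k = 0" by (rule capacity_overload_eq_0[of N0 k, OF assms])
next
  \<comment> \<open>The upper half of the load condition gives positivity, the lower half the strict
    bound.\<close>
  assume k: "(\<lambda>n. real (k n)) \<in> \<Theta>(\<lambda>n. real n / log 2 (real n))"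
  then show "0 < capacity N0 k"
    by (intro capacity_critical_load_pos[of N0 k, OF assms]) (rule bigthetaD1)
  from k show "capacity N0 k < ereal (log 2 (exp 1) / N0)"
    by (intro capacity_critical_load_less[of N0 k, OF assms]) (rule bigthetaD2)
qed


end
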